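(* Let $A$ be a finite alphabet with $|A| \ge 2$ and $0 \in A$, let $X = A^{\mathbb{Z}}$, and let $G_0''$, $G_0'$, $G_0$ be the groups of self-homeomorphisms of $A^{\mathbb{Z}}$ defined in the context. Then the following hold: (1) $G_0$ is finitely generated; (2) $G_0'' = [G_0, G_0]$, and this is a locally finite simple group; (3) $G_0''$ acts $\infty$-transitively on the set $X_0'$ of finite points, i.e. it maps $X_0'$ to itself and for every $k \ge 1$ and any two $k$-tuples $(x_1,\ldots,x_k)$, $(y_1,\ldots,y_k)$ of pairwise distinct elements of $X_0'$ there is $g \in G_0''$ with $g(x_i) = y_i$ for all $i$; (4) there is a unique homomorphism $\psi : G_0 \to \mathbb{Z}$ with $\psi(\sigma) = 1$ and $\psi(G_0') = \{0\}$, and we have $G_0' = \ker(\psi)$.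
   Context: The shift is $\sigma(x)_i = x_{i+1}$ on $A^{\mathbb{Z}}$. For a finite set $N \subset \mathbb{Z}$ and a permutation $\pi : A^N \to A^N$, the local permutation $P_\pi : A^{\mathbb{Z}} \to A^{\mathbb{Z}}$ is the homeomorphism with $P_\pi(x)_i = x_i$ if $i \notin N$ and $P_\pi(x)_i = \pi(x|_N)_i$ if $i \in N$. Define, as groups of homeomorphisms of $A^{\mathbb{Z}}$ under composition: $G_0''$ is generated by all $P_\pi$ where $\pi : A^N \to A^N$ is an even permutation for some finite $N \subset \mathbb{Z}$; $G_0'$ is generated by all $P_\pi$ where $\pi : A^N \to A^N$ is any permutation for some finite $N \subset \mathbb{Z}$; $G_0$ is generated by $\sigma$ and $G_0'$. $[G_0,G_0]$ denotes the commutator subgroup. A finite point is $x \in A^{\mathbb{Z}}$ with $\{i \mid x_i \ne 0\}$ finite; $X_0'$ is the set of all finite points, including $0^{\mathbb{Z}}$. A group is locally finite if each of its finitely generated subgroups is finite. *)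

theory Defs
  imports "HOL-Analysis.Analysis" "HOL-Algebra.Bij" "HOL-Algebra.Elementary_Groups" "HOL-Combinatorics.Permutations"
begin

section \<open>Groups\<close>

definition finitely_generated_group :: "('g, 'm) monoid_scheme \<Rightarrow> bool" where
  "finitely_generated_group G \<longleftrightarrow>
     group G \<and> (\<exists>S. finite S \<and> S \<subseteq> carrier G \<and> generate G S = carrier G)"

definition locally_finite_group :: "('g, 'm) monoid_scheme \<Rightarrow> bool" where
  "locally_finite_group G \<longleftrightarrow>
     group G \<and>
     (\<forall>H. subgroup H G \<longrightarrow> finitely_generated_group (G\<lparr>carrier := H\<rparr>) \<longrightarrow> finite H)"

text \<open>
  The locale \<open>simple_group\<close> of HOL-Algebra requires \<open>order G > 1\<close>, where \<open>order\<close> is a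
  cardinality that is \<open>0\<close> for infinite groups; it therefore excludes every infinite group.
\<close>
definition is_simple_group :: "('g, 'm) monoid_scheme \<Rightarrow> bool" where
  "is_simple_group G \<longleftrightarrow>
     group G \<and> carrier G \<noteq> {\<one>\<^bsub>G\<^esub>} \<and>
     (\<forall>H. H \<lhd> G \<longrightarrow> H = {\<one>\<^bsub>G\<^esub>} \<or> H = carrier G)"

text \<open>For a set \<open>F\<close> of maps (the elements of a group acting on some set containing \<open>S\<close>).\<close>
definition infinitely_transitive_on :: "('x \<Rightarrow> 'x) set \<Rightarrow> 'x set \<Rightarrow> bool" where
  "infinitely_transitive_on F S \<longleftrightarrow>
     (\<forall>g\<in>F. g ` S = S) \<and>
     (\<forall>k\<ge>1. \<forall>x y :: nat \<Rightarrow> 'x.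
        x ` {..<k} \<subseteq> S \<and> inj_on x {..<k} \<and> y ` {..<k} \<subseteq> S \<and> inj_on y {..<k} \<longrightarrow>
        (\<exists>g\<in>F. \<forall>i<k. g (x i) = y i))"

definition homeo_group :: "'x topology \<Rightarrow> ('x \<Rightarrow> 'x) monoid" where
  "homeo_group X =
     (BijGroup (topspace X))
       \<lparr>carrier := {f \<in> Bij (topspace X). homeomorphic_map X X f}\<rparr>"

section \<open>Configurations\<close>

type_synonym 'a config = "int \<Rightarrow> 'a"

definition full_shift :: "'a config topology" where
  "full_shift = product_topology (\<lambda>_. discrete_topology UNIV) UNIV"

definition shift :: "'a config \<Rightarrow> 'a config" where
  "shift x = (\<lambda>i. x (i + 1))"

text \<open>
  \<open>A\<^sup>N\<close> is the set of extensional functions \<open>N \<rightarrow>\<^sub>E UNIV\<close>; a permutation of it is represented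
  by \<open>p\<close> with \<open>p permutes (N \<rightarrow>\<^sub>E UNIV)\<close>, i.e. extended by the identity to all functions.
\<close>
definition local_perm :: "int set \<Rightarrow> ('a config \<Rightarrow> 'a config) \<Rightarrow> 'a config \<Rightarrow> 'a config" where
  "local_perm N p x = (\<lambda>i. if i \<in> N then p (restrict x N) i else x i)"

definition G0'' :: "('a config \<Rightarrow> 'a config) monoid" where
  "G0'' = subgroup_generated (homeo_group full_shift)
     {local_perm N p | N p. finite N \<and> p permutes (N \<rightarrow>\<^sub>E UNIV) \<and> evenperm p}"

definition G0' :: "('a config \<Rightarrow> 'a config) monoid" where
  "G0' = subgroup_generated (homeo_group full_shift)
     {local_perm N p | N p. finite N \<and> p permutes (N \<rightarrow>\<^sub>E UNIV)}"

definition G0 :: "('a config \<Rightarrow> 'a config) monoid" where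
  "G0 = subgroup_generated (homeo_group full_shift) (insert shift (carrier G0'))"

definition finite_points :: "'a::zero config set" where
  "finite_points = {x. finite {i. x i \<noteq> 0}}"

section \<open>Well-definedness\<close>

text \<open>
  \<open>subgroup_generated G S\<close> intersects \<open>S\<close> with \<open>carrier G\<close>; the lemmas below show that this
  discards none of the generators above.
\<close>

lemma topspace_full_shift [simp]: "topspace full_shift = UNIV"
  by (simp add: full_shift_def)

lemma carrier_homeo_group:
  "carrier (homeo_group X) = {f \<in> Bij (topspace X). homeomorphic_map X X f}"
  by (simp add: homeo_group_def)

lemma group_homeo_group: "group (homeo_group X)"
proof -
  let ?H = "{f \<in> Bij (topspace X). homeomorphic_map X X f}"
  interpret B: group "BijGroup (topspace X)" by (rule group_BijGroup)
  have "subgroup ?H (BijGroup (topspace X))"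
  proof (rule B.subgroupI)
    show "?H \<subseteq> carrier (BijGroup (topspace X))" by (auto simp: BijGroup_def)
    have "homeomorphic_map X X (\<lambda>x\<in>topspace X. x)"
      by (rule homeomorphic_map_eq[of X X id]) auto
    then show "?H \<noteq> {}" using id_Bij by blast
  next
    fix f assume f: "f \<in> ?H"
    let ?g = "\<lambda>x\<in>topspace X. inv_into (topspace X) f x"
    have bij: "bij_betw f (topspace X) (topspace X)" using f by (auto simp: Bij_def)
    obtain g where g: "homeomorphic_maps X X f g"
      using f by (auto simp: homeomorphic_map_maps)
    have "?g y = g y" if "y \<in> topspace X" for y
    proof -
      have "g y \<in> topspace X" "f (g y) = y"
        using g that by (auto simp: homeomorphic_maps_def continuous_map_def)
      then show ?thesis
        using that bij by (metis bij_betw_inv_into_left restrict_apply')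
    qed
    moreover have "homeomorphic_map X X g"
      using g by (simp add: homeomorphic_maps_map)
    ultimately have "homeomorphic_map X X ?g"
      using homeomorphic_map_eq by metis
    then show "inv\<^bsub>BijGroup (topspace X)\<^esub> f \<in> ?H"
      using f by (simp add: inv_BijGroup restrict_inv_into_Bij)
  next
    fix f g assume f: "f \<in> ?H" and g: "g \<in> ?H"
    have "homeomorphic_map X X (f \<circ> g)"
      using f g homeomorphic_map_compose by blast
    then have "homeomorphic_map X X (compose (topspace X) f g)"
      by (rule homeomorphic_map_eq) (simp add: compose_def)
    then show "f \<otimes>\<^bsub>BijGroup (topspace X)\<^esub> g \<in> ?H"
      using f g by (simp add: BijGroup_def compose_Bij)
  qed
  then show ?thesis
    unfolding homeo_group_def by (rule B.subgroup_imp_group)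
qed

lemma mult_homeo_group_full_shift:
  assumes "f \<in> carrier (homeo_group full_shift)" "g \<in> carrier (homeo_group full_shift)"
  shows "f \<otimes>\<^bsub>homeo_group full_shift\<^esub> g = f \<circ> g"
  using assms by (auto simp: homeo_group_def BijGroup_def compose_def)

lemma homeo_groupI_full_shift:
  assumes "continuous_map full_shift full_shift f" "continuous_map full_shift full_shift g"
    and "\<And>x. g (f x) = x" "\<And>x. f (g x) = x"
  shows "f \<in> carrier (homeo_group full_shift)"
proof -
  have "homeomorphic_maps full_shift full_shift f g"
    using assms by (simp add: homeomorphic_maps_def)
  then have "homeomorphic_map full_shift full_shift f"
    by (simp add: homeomorphic_maps_map)
  moreover have "bij f"
    using assms(3,4) by (metis bijI')
  ultimately show ?thesis
    by (simp add: carrier_homeo_group Bij_def)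
qed

lemma shift_in_homeo_group: "shift \<in> carrier (homeo_group full_shift)"
proof (rule homeo_groupI_full_shift)
  show "continuous_map full_shift full_shift shift"
    unfolding full_shift_def shift_def continuous_map_componentwise_UNIV
    by (intro allI continuous_map_product_projection) simp
  show "continuous_map full_shift full_shift (\<lambda>x i. x (i - 1))"
    unfolding full_shift_def continuous_map_componentwise_UNIV
    by (intro allI continuous_map_product_projection) simp
qed (auto simp: shift_def)

lemma continuous_map_local_perm:
  assumes "finite N"
  shows "continuous_map full_shift full_shift (local_perm N p)"
proof -
  have proj: "continuous_map full_shift (discrete_topology UNIV) (\<lambda>x. x j)" for j
    unfolding full_shift_def by (intro continuous_map_product_projection) simp
  have "continuous_map full_shift (discrete_topology UNIV) (\<lambda>x. p (restrict x N) i)" for i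
  proof -
    have "openin full_shift {x. p (restrict x N) i \<in> U}" for U
    proof (subst openin_subopen, intro ballI)
      fix x assume x: "x \<in> {x. p (restrict x N) i \<in> U}"
      let ?C = "topspace full_shift \<inter> (\<Inter>j\<in>N. {y. y j = x j})"
      have "openin full_shift {y. y j = x j}" for j
        using openin_continuous_map_preimage[OF proj[of j], of "{x j}"] by simp
      then have "openin full_shift ?C"
        using assms by (intro openin_Int_Inter openin_topspace) auto
      moreover have "x \<in> ?C" by simp
      moreover have "?C \<subseteq> {x. p (restrict x N) i \<in> U}"
      proof
        fix y assume "y \<in> ?C"
        then have "restrict y N = restrict x N" by (auto simp: restrict_def)
        then show "y \<in> {x. p (restrict x N) i \<in> U}" using x by simp
      qed
      ultimately show "\<exists>T. openin full_shift T \<and> x \<in> T \<and> T \<subseteq> {x. p (restrict x N) i \<in> U}"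
        by blast
    qed
    then show ?thesis by (simp add: continuous_map_def)
  qed
  then have "continuous_map full_shift (discrete_topology UNIV) (\<lambda>x. local_perm N p x i)" for i
    using proj by (cases "i \<in> N") (simp_all add: local_perm_def)
  then show ?thesis
    by (simp add: full_shift_def continuous_map_componentwise_UNIV)
qed

lemma restrict_local_perm:
  assumes "p permutes (N \<rightarrow>\<^sub>E UNIV)"
  shows "restrict (local_perm N p x) N = p (restrict x N)"
proof -
  have "p (restrict x N) \<in> N \<rightarrow>\<^sub>E UNIV"
    using permutes_in_image[OF assms] by simp
  then show ?thesis
    by (auto simp: local_perm_def restrict_def PiE_def extensional_def)
qed

lemma local_perm_in_homeo_group:
  assumes "finite N" "p permutes (N \<rightarrow>\<^sub>E UNIV)"
  shows "local_perm N p \<in> carrier (homeo_group full_shift)"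
proof -
  have inverse: "local_perm N q (local_perm N r x) = x"
    if "r permutes (N \<rightarrow>\<^sub>E UNIV)" "\<And>y. q (r y) = y"
    for q r :: "'a config \<Rightarrow> 'a config" and x
  proof
    fix i
    have "local_perm N q (local_perm N r x) i
        = (if i \<in> N then q (r (restrict x N)) i else local_perm N r x i)"
      by (simp only: local_perm_def[of N q] restrict_local_perm[OF that(1)])
    then show "local_perm N q (local_perm N r x) i = x i"
      using that(2) by (simp add: local_perm_def)
  qed
  define q where "q = inv_into UNIV p"
  show ?thesis
  proof (rule homeo_groupI_full_shift)
    show "continuous_map full_shift full_shift (local_perm N p)"
      "continuous_map full_shift full_shift (local_perm N q)"
      by (intro continuous_map_local_perm assms(1))+
    show "local_perm N q (local_perm N p x) = x" for x
      using inverse[OF assms(2)] permutes_inverses(2)[OF assms(2)]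
      unfolding q_def by blast
    show "local_perm N p (local_perm N q x) = x" for x
      using inverse[OF permutes_inv[OF assms(2)]] permutes_inverses(1)[OF assms(2)]
      unfolding q_def by blast
  qed
qed

end

theory Submission
  imports Defs
begin

text \<open>
  \<open>G\<^sub>0'\<close> is the directed union of the symmetric groups on the words \<open>A\<^sup>N\<close>, and every element of
  \<open>G\<^sub>0\<close> is uniquely a power of the shift times an element of \<open>G\<^sub>0'\<close>; the exponent is \<open>\<psi>\<close>.
  Enlarging a window by one site turns a transposition into a product of \<open>|A|\<close> disjoint
  transpositions. So parity is either preserved (\<open>|A|\<close> odd) or killed (\<open>|A|\<close> even), and in both cases
  it is a translation-invariant homomorphism with kernel \<open>G\<^sub>0''\<close>, which gives \<open>[G\<^sub>0, G\<^sub>0] \<subseteq> G\<^sub>0''\<close>.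

  Everything else rests on one fact: if the supports of \<open>f\<close> and \<open>g\<close> meet in the single point \<open>x\<close>, then
  \<open>[f, g]\<close> is the three-cycle \<open>(x, f x, g x)\<close>. Applied inside one window it shows that even maps are
  products of commutators; applied to two overlapping windows it builds the three-cycles on a window of
  length \<open>n + 1\<close> from those on windows of length \<open>n\<close>, so the shift and the window \<open>{0, 1, 2}\<close> generate
  \<open>G\<^sub>0\<close>; and commutators of three-cycles with a nontrivial element of a normal subgroup \<open>K\<close> of \<open>G\<^sub>0''\<close>
  produce a three-cycle in \<open>K\<close>, hence all of them.
\<close>

section \<open>Three-cycles in finite permutation groups\<close>

abbreviation transposition :: "'b \<Rightarrow> 'b \<Rightarrow> 'b \<Rightarrow> 'b" where
  "transposition \<equiv> Transposition.transpose"

abbreviation inv_fun :: "('b \<Rightarrow> 'c) \<Rightarrow> 'c \<Rightarrow> 'b" where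
  "inv_fun \<equiv> inv_into UNIV"

text \<open>Written as a product of two transpositions so that its parity is immediate. With
  repeated entries it can degenerate to the identity or a transposition, hence the
  \<open>distinct\<close> assumptions below.\<close>

definition cyc3 :: "'b \<Rightarrow> 'b \<Rightarrow> 'b \<Rightarrow> 'b \<Rightarrow> 'b" where
  "cyc3 x y z = transposition x y \<circ> transposition y z"

lemma cyc3_apply:
  assumes "distinct [x, y, z]"
  shows "cyc3 x y z t = (if t = x then y else if t = y then z else if t = z then x else t)"
  using assms by (auto simp: cyc3_def Transposition.transpose_def)

lemma cyc3_permutes: "x \<in> S \<Longrightarrow> y \<in> S \<Longrightarrow> z \<in> S \<Longrightarrow> cyc3 x y z permutes S"
  unfolding cyc3_def by (intro permutes_compose permutes_swap_id)

lemma evenperm_cyc3: "distinct [x, y, z] \<Longrightarrow> evenperm (cyc3 x y z)"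
  unfolding cyc3_def by (subst evenperm_comp) (auto simp: permutation_swap_id evenperm_swap)

lemma cyc3_rotate: "distinct [x, y, z] \<Longrightarrow> cyc3 x y z = cyc3 y z x"
  by (auto simp: cyc3_apply fun_eq_iff)

lemma inv_cyc3: "distinct [x, y, z] \<Longrightarrow> inv_fun (cyc3 x y z) = cyc3 z y x"
  by (rule inv_unique_comp) (auto simp: cyc3_apply fun_eq_iff split: if_splits)

lemma conj_cyc3:
  assumes "bij f" "distinct [x, y, z]"
  shows "f \<circ> cyc3 x y z \<circ> inv_fun f = cyc3 (f x) (f y) (f z)"
proof
  fix t
  obtain s where t: "t = f s" using assms(1) by (metis bij_pointE)
  have "distinct [f x, f y, f z]" using assms by (auto simp: bij_def dest: injD)
  then show "(f \<circ> cyc3 x y z \<circ> inv_fun f) t = cyc3 (f x) (f y) (f z) t"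
    using assms by (auto simp: t cyc3_apply bij_is_inj bij_def inj_eq)
qed

text \<open>The image of a point moved by \<open>f\<close> is again moved by \<open>f\<close>, so
  \<open>f x\<close> is fixed by \<open>g\<close>, and likewise \<open>g x\<close> by
  \<open>f\<close>. The identity is proved as
  \<open>f \<circ> g = cyc3 x (f x) (g x) \<circ> g \<circ> f\<close>, so that only forward images
  have to be traced.\<close>

lemma commutator_cyc3:
  assumes f: "bij f" and g: "bij g" and x: "f x \<noteq> x" "g x \<noteq> x"
    and disj: "\<And>y. y \<noteq> x \<Longrightarrow> f y = y \<or> g y = y"
  shows "distinct [x, f x, g x]" "f \<circ> g \<circ> inv_fun f \<circ> inv_fun g = cyc3 x (f x) (g x)"
proof -
  have fi: "f a = f b \<longleftrightarrow> a = b" and gi: "g a = g b \<longleftrightarrow> a = b" for a b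
    using f g by (auto simp: bij_def inj_eq)
  have fx: "g (f x) = f x" using disj[of "f x"] x fi by metis
  have gx: "f (g x) = g x" using disj[of "g x"] x gi by metis
  show d: "distinct [x, f x, g x]" using x fx gi by auto
  have "f (g t) = cyc3 x (f x) (g x) (g (f t))" for t
  proof (cases "f t = x")
    case True
    then have "t \<noteq> x" using x by auto
    then have "g t = t" using disj[of t] True by auto
    then show ?thesis using True d x by (simp add: cyc3_apply)
  next
    case ft: False
    show ?thesis
    proof (cases "t = x")
      case True
      then show ?thesis using d fx gx x by (simp add: cyc3_apply)
    next
      case tx: False
      have a: "f t \<noteq> f x" using tx fi by simp
      consider "f t = t" | "f t \<noteq> t" "g t = t" using disj[OF tx] by auto
      then show ?thesis
      proof cases
        case 1
        show ?thesis
        proof (cases "g t = x")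
          case True
          then show ?thesis using 1 d by (simp add: cyc3_apply)
        next
          case False
          then have "f (g t) = g t" using disj[of "g t"] 1 gi by metis
          moreover have "g t \<noteq> f x" using fx gi a 1 by metis
          ultimately show ?thesis using 1 False tx d gi by (simp add: cyc3_apply)
        qed
      next
        case 2
        have "g (f t) = f t" using disj[OF ft] 2 fi by metis
        moreover have "f t \<noteq> g x" using gx fi 2 x gi tx by metis
        ultimately show ?thesis using 2 ft a d by (simp add: cyc3_apply)
      qed
    qed
  qed
  then have "f \<circ> g = cyc3 x (f x) (g x) \<circ> g \<circ> f" by (simp add: fun_eq_iff)
  then show "f \<circ> g \<circ> inv_fun f \<circ> inv_fun g = cyc3 x (f x) (g x)"
    using f g by (simp add: fun_eq_iff bij_is_surj surj_f_inv_f)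
qed

text \<open>Conjugation by \<open>k\<close> moves the three-cycle one step along the path of
  \<open>x\<close>. Old and new three-cycle share two points, and their quotient is again a
  three-cycle.\<close>

lemma commutator_path4:
  assumes k: "bij k" and d: "distinct [x, k x, k (k x), k (k (k x))]"
  shows "k \<circ> cyc3 x (k x) (k (k x)) \<circ> inv_fun k \<circ> inv_fun (cyc3 x (k x) (k (k x)))
    = cyc3 x (k (k (k x))) (k x)"
proof -
  have "k \<circ> cyc3 x (k x) (k (k x)) \<circ> inv_fun k = cyc3 (k x) (k (k x)) (k (k (k x)))"
    using conj_cyc3[OF k, of x "k x" "k (k x)"] d by simp
  moreover have "cyc3 (k x) (k (k x)) (k (k (k x))) \<circ> cyc3 (k (k x)) (k x) x
    = cyc3 x (k (k (k x))) (k x)"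
    using d by (auto simp: cyc3_apply fun_eq_iff)
  ultimately show ?thesis using d by (simp add: inv_cyc3)
qed

text \<open>Three-cycles generate the alternating group: a product of two transpositions sharing a
  point is a three-cycle or the identity, and any other product of two is reduced to this by
  inserting a transposition twice.\<close>

lemma even_permutes_in:
  fixes G :: "('b \<Rightarrow> 'b) set"
  assumes S: "finite S" and idG: "id \<in> G" and comp: "\<And>f g. f \<in> G \<Longrightarrow> g \<in> G \<Longrightarrow> f \<circ> g \<in> G"
    and cyc: "\<And>x y z. \<lbrakk>x \<in> S; y \<in> S; z \<in> S; distinct [x, y, z]\<rbrakk> \<Longrightarrow> cyc3 x y z \<in> G"
    and p: "p permutes S" "evenperm p"
  shows "p \<in> G"
proof (cases "\<exists>u\<in>S. \<exists>v\<in>S. u \<noteq> v")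
  case False
  then have "p = id"
    using p(1) by (metis eq_id_iff permutes_in_image permutes_not_in)
  then show ?thesis using idG by simp
next
  case True
  then obtain u v where uv: "u \<in> S" "v \<in> S" "u \<noteq> v" by blast
  have share: "transposition a b \<circ> transposition b c \<in> G" if "a \<in> S" "b \<in> S" "c \<in> S" "a \<noteq> b" "b \<noteq> c" for a b c
  proof (cases "a = c")
    case True
    then show ?thesis using idG by (simp add: transpose_commute[of c b] id_def)
  next
    case False
    then show ?thesis using cyc[of a b c] that by (simp add: cyc3_def)
  qed
  have pair: "transposition a b \<circ> transposition c d \<in> G"
    if "a \<in> S" "b \<in> S" "c \<in> S" "d \<in> S" "a \<noteq> b" "c \<noteq> d" for a b c d
  proof (cases "b = c")
    case True
    then show ?thesis using share[of a b d] that by simp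
  next
    case False
    have "transposition a b \<circ> transposition c d
      = (transposition a b \<circ> transposition b c) \<circ> (transposition b c \<circ> transposition c d)"
      by (simp add: fun_eq_iff)
    also have "\<dots> \<in> G" using share[of a b c] share[of b c d] that False comp by blast
    finally show ?thesis .
  qed
  \<comment> \<open>Adding transpositions one at a time passes through odd permutations; these are
    carried along after multiplication by the fixed transposition of \<open>u\<close> and
    \<open>v\<close>.\<close>
  have "(evenperm p \<longrightarrow> p \<in> G) \<and> (\<not> evenperm p \<longrightarrow> transposition u v \<circ> p \<in> G)"
    using p(1) S
  proof (induction rule: permutes_induct)
    case id
    show ?case using idG by (simp only: evenperm_id simp_thms)
  next
    case (swap a b p)
    have ev: "evenperm (transposition a b \<circ> p) \<longleftrightarrow> \<not> evenperm p"
      using \<open>a \<noteq> b\<close> permutes_imp_permutation[OF S \<open>p permutes S\<close>]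
      by (simp add: evenperm_comp permutation_swap_id evenperm_swap)
    show ?case
    proof (cases "evenperm p")
      case True
      then have "(transposition u v \<circ> transposition a b) \<circ> p \<in> G"
        using swap pair[of u v a b] uv comp by blast
      then show ?thesis using ev True by (simp only: comp_assoc simp_thms)
    next
      case False
      then have "(transposition a b \<circ> transposition u v) \<circ> (transposition u v \<circ> p) \<in> G"
        using swap pair[of a b u v] uv comp by blast
      moreover have "(transposition a b \<circ> transposition u v) \<circ> (transposition u v \<circ> p) = transposition a b \<circ> p"
        by (simp add: fun_eq_iff)
      ultimately show ?thesis using ev False by (simp only: simp_thms)
    qed
  qed
  then show ?thesis using p by simp
qed

text \<open>Extend \<open>f\<close> to any permutation of \<open>S\<close>; if it is odd, compose it
  with a transposition of two points outside the image of \<open>T\<close>.\<close>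

lemma ex_even_permutes:
  assumes S: "finite S" and T: "T \<subseteq> S" "card T + 2 \<le> card S" and f: "inj_on f T" "f ` T \<subseteq> S"
  obtains p where "p permutes S" "evenperm p" "\<And>x. x \<in> T \<Longrightarrow> p x = f x"
proof -
  have fin: "finite T" using S T finite_subset by blast
  have c: "card (S - T) = card (S - f ` T)"
    using S T f fin by (simp add: card_Diff_subset card_image)
  then obtain h where h: "bij_betw h (S - T) (S - f ` T)"
    using S by (metis finite_Diff finite_same_card_bij)
  define q where "q x = (if x \<in> T then f x else if x \<in> S then h x else x)" for x
  have "bij_betw q T (f ` T)"
    using f by (simp add: q_def bij_betw_def inj_on_def image_def)
  moreover have "bij_betw q (S - T) (S - f ` T)"
    using h by (rule bij_betw_cong[THEN iffD1, rotated]) (simp add: q_def)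
  ultimately have "bij_betw q (T \<union> (S - T)) (f ` T \<union> (S - f ` T))"
    by (rule bij_betw_combine) auto
  then have "bij_betw q S S" using T f by (simp add: Un_absorb1)
  then have q: "q permutes S" using T by (intro bij_imp_permutes) (auto simp: q_def)
  have "2 \<le> card (S - f ` T)" using S T f fin by (simp add: card_Diff_subset card_image)
  then obtain u v where uv: "u \<in> S - f ` T" "v \<in> S - f ` T" "u \<noteq> v"
    by (metis One_nat_def Suc_1 card.empty card_le_Suc0_iff_eq S finite_Diff not_less_eq_eq)
  define p where "p = (if evenperm q then q else transposition u v \<circ> q)"
  show thesis
  proof
    show "p permutes S" using q uv by (auto simp: p_def intro: permutes_compose permutes_swap_id)
    have "permutation q" using q S permutes_imp_permutation by blast
    then show "evenperm p" using uv
      by (auto simp: p_def evenperm_comp permutation_swap_id evenperm_swap)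
    show "p x = f x" if "x \<in> T" for x
      using that uv by (auto simp: p_def q_def Transposition.transpose_def)
  qed
qed

text \<open>Two points are linked if a three-cycle of \<open>G\<close> sends one to the other.
  Conjugating one three-cycle by another shows that links compose, so connectedness alone yields
  every three-cycle on \<open>S\<close>.\<close>

lemma cyc3_mem_of_linked:
  fixes G :: "('b \<Rightarrow> 'b) set"
  assumes bij: "\<And>f. f \<in> G \<Longrightarrow> bij f"
    and comp: "\<And>f g. f \<in> G \<Longrightarrow> g \<in> G \<Longrightarrow> f \<circ> g \<in> G"
    and inv: "\<And>f. f \<in> G \<Longrightarrow> inv_fun f \<in> G"
    and linked: "\<And>x y. \<lbrakk>x \<in> S; y \<in> S; x \<noteq> y\<rbrakk> \<Longrightarrow>
      (\<lambda>x y. \<exists>z. distinct [x, y, z] \<and> cyc3 x y z \<in> G)\<^sup>*\<^sup>* x y"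
    and xyz: "x \<in> S" "y \<in> S" "z \<in> S" "distinct [x, y, z]"
  shows "cyc3 x y z \<in> G"
proof -
  define R where "R x y \<longleftrightarrow> (\<exists>z. distinct [x, y, z] \<and> cyc3 x y z \<in> G)" for x y
  have conjG: "cyc3 (f x) (f y) (f z) \<in> G" if "f \<in> G" "cyc3 x y z \<in> G" "distinct [x, y, z]" for f x y z
    using conj_cyc3[OF bij[OF that(1)] that(3)] comp inv that by metis
  have invG: "cyc3 z y x \<in> G" if "cyc3 x y z \<in> G" "distinct [x, y, z]" for x y z
    using inv[OF that(1)] inv_cyc3[OF that(2)] by simp
  have rot: "cyc3 y z x \<in> G" if "cyc3 x y z \<in> G" "distinct [x, y, z]" for x y z
    using that cyc3_rotate by metis
  have path: "cyc3 x y w \<in> G"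
    if xy: "R x y" and yw: "R y w" and d: "distinct [x, y, w]" for x y w
  proof -
    obtain z where z: "distinct [x, y, z]" "cyc3 x y z \<in> G" using xy R_def by auto
    obtain v where v: "distinct [y, w, v]" "cyc3 y w v \<in> G" using yw R_def by auto
    consider "z = w" | "v = x" | "z \<noteq> w" "v \<noteq> x" "v = z" | "z \<noteq> w" "v \<noteq> x" "v \<noteq> z" by blast
    then show ?thesis
    proof cases
      case 1
      then show ?thesis using z by simp
    next
      case 2
      then show ?thesis using v rot[of y w x] rot[of w x y] d by auto
    next
      case 3
      have "cyc3 x w y \<in> G"
        using conjG[OF v(2) z(2) z(1)] 3 z(1) v(1) d by (auto simp: cyc3_apply)
      then show ?thesis using invG[of x w y] rot[of y w x] rot[of w x y] d by auto
    next
      case 4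
      \<comment> \<open>The generic case. Conjugating (x, y, z) by (y, w, v) gives (x, w, z);
        conjugating (x, y, z) by that gives (w, y, x), the inverse of the cycle sought.\<close>
      have xwz: "cyc3 x w z \<in> G"
        using conjG[OF v(2) z(2) z(1)] 4 z(1) v(1) d by (auto simp: cyc3_apply)
      have "cyc3 w y x \<in> G"
        using conjG[OF xwz z(2) z(1)] 4 z(1) v(1) d by (auto simp: cyc3_apply)
      then show ?thesis using invG[of w y x] d by auto
    qed
  qed
  have link: "R x y" if "x \<in> S" "y \<in> S" "x \<noteq> y" for x y
  proof -
    have "R\<^sup>*\<^sup>* x y" using linked[OF that] R_def by presburger
    then have "x = y \<or> R x y"
    proof (induction rule: rtranclp_induct)
      case (step y z)
      show ?case
      proof (cases "x = y \<or> x = z")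
        case False
        moreover have "y \<noteq> z" using step R_def by auto
        ultimately have "cyc3 x y z \<in> G" "distinct [x, y, z]"
          using step.IH step.hyps path by auto
        then have "cyc3 x z y \<in> G" using invG[of x y z] rot[of z y x] rot[of y x z] by auto
        then show ?thesis using \<open>distinct [x, y, z]\<close> unfolding R_def by auto
      qed (use step in auto)
    qed simp
    then show ?thesis using that by simp
  qed
  show ?thesis using path link xyz by simp
qed

text \<open>What a normal subgroup of \<open>G0''\<close> leaves on the words of one finite window:
  permutations closed under products, inverses and conjugation by the alternating group.\<close>

locale even_conj_closed =
  fixes S :: "'b set" and K :: "('b \<Rightarrow> 'b) set"
  assumes finite_S: "finite S"
    and permutes: "k \<in> K \<Longrightarrow> k permutes S"
    and comp: "k \<in> K \<Longrightarrow> l \<in> K \<Longrightarrow> k \<circ> l \<in> K"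
    and inverse: "k \<in> K \<Longrightarrow> inv_fun k \<in> K"
    and conj: "k \<in> K \<Longrightarrow> c permutes S \<Longrightarrow> evenperm c \<Longrightarrow> c \<circ> k \<circ> inv_fun c \<in> K"
begin

lemma commutator:
  assumes "k \<in> K" "c permutes S" "evenperm c"
  shows "k \<circ> c \<circ> inv_fun k \<circ> inv_fun c \<in> K"
  using comp[OF assms(1) conj[OF inverse[OF assms(1)] assms(2,3)]] by (simp add: comp_assoc)

lemma commutator_of_cyc3:
  assumes "k \<in> K" "x \<in> S" "y \<in> S" "z \<in> S" "distinct [x, y, z]"
  shows "cyc3 (k x) (k y) (k z) \<circ> cyc3 z y x \<in> K"
  using commutator[OF assms(1) cyc3_permutes[OF assms(2-4)] evenperm_cyc3[OF assms(5)]]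
    conj_cyc3[OF permutes_bij[OF permutes[OF assms(1)]] assms(5)] inv_cyc3[OF assms(5)] by simp

lemma ex_cyc3:
  assumes h: "h \<in> K" and S: "x \<in> S" "y \<in> S" "z \<in> S"
    and d: "distinct [x, y, z, h x, h y, h z]"
  obtains a b c where "a \<in> S" "b \<in> S" "c \<in> S" "distinct [a, b, c]" "cyc3 a b c \<in> K"
proof -
  have inS: "l s \<in> S" if "l \<in> K" "s \<in> S" for l s
    using permutes[OF that(1)] that(2) by (simp add: permutes_in_image)
  \<comment> \<open>\<open>k\<close> is the commutator of \<open>h\<close> with
    \<open>cyc3 x y z\<close>. As the six points are distinct, it is a product of two disjoint
    three-cycles.\<close>
  define k where "k = cyc3 (h x) (h y) (h z) \<circ> cyc3 z y x"
  have k: "k \<in> K" unfolding k_def using commutator_of_cyc3[OF h S] d by simp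
  have kv: "k x = z" "k z = y" "k (h x) = h y"
    using d by (auto simp: k_def cyc3_apply)
  \<comment> \<open>A second commutator, with a three-cycle meeting both cycles of \<open>k\<close>,
    gives the five-cycle x, h x, y, h y, z, whose first four points fit
    \<open>commutator_path4\<close>.\<close>
  define l where "l = cyc3 (k x) (k z) (k (h x)) \<circ> cyc3 (h x) z x"
  have l: "l \<in> K" unfolding l_def using commutator_of_cyc3[OF k, of x z "h x"] S inS[OF h] d by simp
  have lv: "l x = h x" "l (h x) = y" "l y = h y"
    using d kv by (auto simp: l_def cyc3_apply)
  have "l \<circ> cyc3 x (h x) y \<circ> inv_fun l \<circ> inv_fun (cyc3 x (h x) y) \<in> K"
    by (rule commutator[OF l cyc3_permutes[OF S(1) inS[OF h S(1)] S(2)] evenperm_cyc3]) (use d in auto)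
  moreover have "l \<circ> cyc3 x (h x) y \<circ> inv_fun l \<circ> inv_fun (cyc3 x (h x) y) = cyc3 x (h y) (h x)"
    
    using commutator_path4[OF permutes_bij[OF permutes[OF l]], of x] d unfolding lv by auto
  ultimately have "cyc3 x (h y) (h x) \<in> K" by (simp only:)
  moreover have "distinct [x, h y, h x]" using d by auto
  ultimately show thesis using that S inS[OF h] by blast
qed

text \<open>Among five points, two stay free besides any three, so an even permutation carries
  \<open>a\<close>, \<open>b\<close>, \<open>c\<close> to any prescribed triple, and conjugation by
  it turns the given three-cycle into any other.\<close>

lemma even_mem:
  assumes card: "card S \<ge> 5"
    and abc: "a \<in> S" "b \<in> S" "c \<in> S" "distinct [a, b, c]" "cyc3 a b c \<in> K"
    and p: "p permutes S" "evenperm p"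
  shows "p \<in> K"
proof (rule even_permutes_in[OF finite_S _ _ _ p])
  show "k \<circ> l \<in> K" if "k \<in> K" "l \<in> K" for k l using comp that .
  show "id \<in> K"
    using comp[OF abc(5) inverse[OF abc(5)]]
    unfolding permutes_inv_o(1)[OF permutes[OF abc(5)]] .
  fix x y z assume xyz: "x \<in> S" "y \<in> S" "z \<in> S" "distinct [x, y, z]"
  let ?f = "\<lambda>t. if t = a then x else if t = b then y else z"
  have "card {a, b, c} = 3" using abc(4) by simp
  then have c: "card {a, b, c} + 2 \<le> card S" using card by simp
  have sub: "{a, b, c} \<subseteq> S" "?f ` {a, b, c} \<subseteq> S" using abc(1-3) xyz(1-3) by auto
  have inj: "inj_on ?f {a, b, c}"
    using abc(4) xyz(4) by (intro inj_onI) (auto split: if_splits)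
  obtain q where q: "q permutes S" "evenperm q" and f: "\<And>t. t \<in> {a, b, c} \<Longrightarrow> q t = ?f t"
    by (rule ex_even_permutes[OF finite_S sub(1) c inj sub(2)]) (assumption | rule that)+
  have "q a = ?f a" "q b = ?f b" "q c = ?f c" by (rule f, simp)+
  moreover have "b \<noteq> a" "c \<noteq> a" "c \<noteq> b" using abc(4) by auto
  ultimately have "q a = x" "q b = y" "q c = z" by simp_all
  then show "cyc3 x y z \<in> K"
    
    using conj[OF abc(5) q(1,2)] unfolding conj_cyc3[OF permutes_bij[OF q(1)] abc(4)] by simp
qed

end

section \<open>Local maps on a window\<close>

text \<open>A word is itself a configuration, with filler \<open>undefined\<close> outside
  \<open>N\<close>, so local maps act on words directly.\<close>

definition words :: "int set \<Rightarrow> 'a config set" where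
  "words N = N \<rightarrow>\<^sub>E UNIV"

definition local_group :: "int set \<Rightarrow> ('a config \<Rightarrow> 'a config) set" where
  "local_group N = {local_perm N p | p. p permutes words N}"

text \<open>Restricting a local map to words recovers its permutation; the identity elsewhere makes
  \<open>permutes\<close> and \<open>evenperm\<close> applicable.\<close>

definition word_map :: "int set \<Rightarrow> ('a config \<Rightarrow> 'a config) \<Rightarrow> 'a config \<Rightarrow> 'a config" where
  "word_map N f x = (if x \<in> words N then f x else x)"

lemma words_iff: "x \<in> words N \<longleftrightarrow> (\<forall>i. i \<notin> N \<longrightarrow> x i = undefined)"
  by (auto simp: words_def PiE_def extensional_def)

lemma restrict_in_words [simp]: "restrict x N \<in> words N"
  by (simp add: words_iff)

lemma restrict_word: "x \<in> words N \<Longrightarrow> restrict x N = x"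
  by (auto simp: words_iff restrict_def)

lemma finite_words: "finite N \<Longrightarrow> finite (words N :: 'a::finite config set)"
  unfolding words_def by (rule finite_PiE) auto

lemma card_words: "finite N \<Longrightarrow> card (words N :: 'a::finite config set) = CARD('a) ^ card N"
  unfolding words_def by (simp add: card_PiE)

lemma permutes_wordsD: "p permutes words N \<Longrightarrow> x \<in> words N \<Longrightarrow> p x \<in> words N"
  by (simp add: permutes_in_image)

lemma restrict_local_perm_words:
  "p permutes words N \<Longrightarrow> restrict (local_perm N p x) N = p (restrict x N)"
  using restrict_local_perm by (simp add: words_def)

lemma local_perm_comp:
  assumes "p permutes words N"
  shows "local_perm N (q \<circ> p) = local_perm N q \<circ> local_perm N p"
proof (intro ext)
  fix x i
  have "local_perm N q (local_perm N p x) i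
    = (if i \<in> N then q (p (restrict x N)) i else x i)"
    unfolding local_perm_def[of N q] restrict_local_perm_words[OF assms] by (simp add: local_perm_def)
  then show "local_perm N (q \<circ> p) x i = (local_perm N q \<circ> local_perm N p) x i"
    by (simp add: local_perm_def)
qed

lemma local_perm_id: "local_perm N id = id"
  by (auto simp: local_perm_def fun_eq_iff)

lemma bij_local_perm: "p permutes words N \<Longrightarrow> bij (local_perm N p)"
  and inv_local_perm: "p permutes words N \<Longrightarrow> inv_fun (local_perm N p) = local_perm N (inv_fun p)"
proof -
  assume p: "p permutes words N"
  have *: "local_perm N (inv_fun p) \<circ> local_perm N p = id" "local_perm N p \<circ> local_perm N (inv_fun p) = id"
    using local_perm_comp[OF p, of "inv_fun p"] local_perm_comp[OF permutes_inv[OF p], of p]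
    by (simp_all add: permutes_inv_o[OF p] local_perm_id)
  then show "bij (local_perm N p)" by (metis o_bij)
  show "inv_fun (local_perm N p) = local_perm N (inv_fun p)" using * by (intro inv_unique_comp)
qed

lemma local_perm_word:
  assumes "p permutes words N" "x \<in> words N"
  shows "local_perm N p x = p x"
proof
  fix i
  show "local_perm N p x i = p x i"
    using assms permutes_wordsD[OF assms] by (simp add: local_perm_def restrict_word words_iff)
qed

lemma word_map_local_perm: "p permutes words N \<Longrightarrow> word_map N (local_perm N p) = p"
  by (auto simp: word_map_def fun_eq_iff local_perm_word permutes_not_in)

lemma local_groupE:
  assumes "f \<in> local_group N"
  obtains "word_map N f permutes words N" "f = local_perm N (word_map N f)"
  using assms by (auto simp: local_group_def word_map_local_perm)

lemma local_groupI: "p permutes words N \<Longrightarrow> local_perm N p \<in> local_group N"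
  by (auto simp: local_group_def)

lemma local_group_words: "f \<in> local_group N \<Longrightarrow> x \<in> words N \<Longrightarrow> f x \<in> words N"
  by (metis local_groupE permutes_wordsD word_map_def)

lemma bij_local_group: "f \<in> local_group N \<Longrightarrow> bij f"
  by (metis local_groupE bij_local_perm)

lemma local_group_id: "id \<in> local_group N"
  using local_groupI[OF permutes_id] by (simp add: local_perm_id)

lemma local_group_comp: "f \<in> local_group N \<Longrightarrow> g \<in> local_group N \<Longrightarrow> f \<circ> g \<in> local_group N"
  by (auto simp: local_group_def local_perm_comp[symmetric] intro: permutes_compose)

lemma local_group_inv: "f \<in> local_group N \<Longrightarrow> inv_fun f \<in> local_group N"
  by (auto simp: local_group_def inv_local_perm intro: permutes_inv)

lemma word_map_comp:
  assumes "g \<in> local_group N"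
  shows "word_map N (f \<circ> g) = word_map N f \<circ> word_map N g"
  using local_group_words[OF assms] by (auto simp: word_map_def fun_eq_iff)

lemma word_map_id: "word_map N id = id"
  by (auto simp: word_map_def fun_eq_iff)

lemma word_map_permutes: "f \<in> local_group N \<Longrightarrow> word_map N f permutes words N"
  by (metis local_groupE)

lemma finite_local_group:
  assumes "finite N"
  shows "finite (local_group N :: ('a::finite config \<Rightarrow> 'a config) set)"
proof -
  have "local_group N = local_perm N ` {p. p permutes (words N :: 'a config set)}"
    by (auto simp: local_group_def)
  then show ?thesis using finite_permutations[OF finite_words[OF assms, where 'a = 'a]] by simp
qed

lemma local_group_outside: "f \<in> local_group N \<Longrightarrow> i \<notin> N \<Longrightarrow> f x i = x i"
  by (auto simp: local_group_def local_perm_def)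

lemma local_group_cong:
  assumes "f \<in> local_group N" "\<And>i. i \<in> N \<Longrightarrow> x i = y i" "i \<in> N"
  shows "f x i = f y i"
proof -
  have "restrict x N = restrict y N" using assms(2) by (auto simp: restrict_def)
  then show ?thesis using assms by (auto simp: local_group_def local_perm_def)
qed

text \<open>Locality without reference to a permutation. In this form, enlarging and translating
  windows need no computation with \<open>local_perm\<close>.\<close>

lemma local_group_iff:
  fixes f :: "'a config \<Rightarrow> 'a config"
  shows "f \<in> local_group N \<longleftrightarrow> bij f \<and> (\<forall>x i. i \<notin> N \<longrightarrow> f x i = x i)
     \<and> (\<forall>x y. (\<forall>i\<in>N. x i = y i) \<longrightarrow> (\<forall>i\<in>N. f x i = f y i))"
  (is "?L \<longleftrightarrow> ?R")
proof
  assume ?L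
  then show ?R
    by (intro conjI allI impI ballI) (blast intro: bij_local_group local_group_outside local_group_cong)+
next
  assume R: ?R
  have w: "f x \<in> words N" if "x \<in> words N" for x :: "'a config"
    using R that by (simp add: words_iff)
  have "bij_betw (word_map N f) (words N) (words N)"
  proof (rule bij_betw_imageI)
    show "inj_on (word_map N f) (words N)"
      using R by (auto simp: word_map_def inj_on_def bij_def)
    show "word_map N f ` words N = words N"
    proof
      show "word_map N f ` words N \<subseteq> words N" using w by (auto simp: word_map_def)
      show "words N \<subseteq> word_map N f ` words N"
      proof
        fix y :: "'a config" assume y: "y \<in> words N"
        obtain x where x: "y = f x" using R by (metis bij_pointE)
        \<comment> \<open>The preimage of a word is a word because \<open>f\<close> leaves the sites
          outside \<open>N\<close> unchanged.\<close>
        have "x \<in> words N" using y R x by (simp add: words_iff)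
        then show "y \<in> word_map N f ` words N" using x by (auto simp: word_map_def)
      qed
    qed
  qed
  then have p: "word_map N f permutes words N"
    by (rule bij_imp_permutes) (simp add: word_map_def)
  have "f x i = local_perm N (word_map N f) x i" for x i
    using R by (auto simp: local_perm_def word_map_def)
  then have "f = local_perm N (word_map N f)" by blast
  then show ?L using local_groupI[OF p] by simp
qed

lemma local_group_mono:
  assumes "N \<subseteq> M" "f \<in> local_group N"
  shows "f \<in> local_group M"
proof -
  have "f x i = f y i" if "\<forall>i\<in>M. x i = y i" "i \<in> M" for x y i
    using that assms local_group_outside[OF assms(2)] local_group_cong[OF assms(2)]
    by (metis subsetD)
  then show ?thesis
    using assms unfolding local_group_iff by blast
qed

section \<open>Parity relative to a window, and its behaviour under enlargement\<close>

definition even_on :: "int set \<Rightarrow> ('a config \<Rightarrow> 'a config) \<Rightarrow> bool" where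
  "even_on N f \<longleftrightarrow> evenperm (word_map N f)"

lemma permutation_word_map:
  "finite N \<Longrightarrow> f \<in> local_group N \<Longrightarrow> permutation (word_map N (f :: 'a::finite config \<Rightarrow> 'a config))"
  using permutes_imp_permutation[OF finite_words word_map_permutes] .

lemma even_on_comp:
  fixes f g :: "'a::finite config \<Rightarrow> 'a config"
  assumes "finite N" "f \<in> local_group N" "g \<in> local_group N"
  shows "even_on N (f \<circ> g) \<longleftrightarrow> (even_on N f \<longleftrightarrow> even_on N g)"
  using assms unfolding even_on_def
  by (simp add: word_map_comp evenperm_comp permutation_word_map)

lemma even_on_id: "even_on N id"
  by (simp add: even_on_def word_map_id)

text \<open>On the window with \<open>j\<close> added, the transposition splits into the
  transpositions of \<open>a(j := c)\<close> and \<open>b(j := c)\<close>, one for each letter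
  \<open>c\<close>.\<close>

lemma even_on_transposition_insert:
  fixes a b :: "'a::finite config"
  assumes j: "j \<notin> N" and N: "finite N" and ab: "a \<in> words N" "b \<in> words N" "a \<noteq> b"
  shows "even_on (insert j N) (local_perm N (transposition a b)) \<longleftrightarrow> even CARD('a)"
proof -
  let ?M = "insert j N" and ?t = "local_perm N (transposition a b)"
  have tp: "transposition a b permutes words N" using ab by (simp add: permutes_swap_id)
  have t: "?t \<in> local_group N" using local_groupI[OF tp] .
  \<comment> \<open>Induction over a set \<open>C\<close> of letters: \<open>q\<close> acts like
    \<open>?t\<close> on words whose letter at \<open>j\<close> is in \<open>C\<close> and fixes
    everything else. Each new letter contributes one transposition.\<close>
  have partial: "\<exists>q. permutation q \<and> (evenperm q \<longleftrightarrow> even (card C))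
      \<and> (\<forall>y. q y = (if y \<in> words ?M \<and> y j \<in> C then ?t y else y))" if "finite C" for C :: "'a set"
    using that
  proof (induction C)
    case empty
    show ?case by (rule exI[of _ id]) (simp add: id_def)
  next
    case (insert c C)
    then obtain q where q: "permutation q" "evenperm q \<longleftrightarrow> even (card C)"
      "\<And>y. q y = (if y \<in> words ?M \<and> y j \<in> C then ?t y else y)" by blast
    let ?a = "a(j := c)" and ?b = "b(j := c)"
    have aj: "restrict ?a N = a" "restrict ?b N = b"
      using ab j by (auto simp: words_iff restrict_def)
    have ne: "?a \<noteq> ?b" using aj ab(3) by metis
    have M: "?a \<in> words ?M" "?b \<in> words ?M" using ab by (auto simp: words_iff)
    let ?q = "transposition ?a ?b \<circ> q"
    have "?q y = (if y \<in> words ?M \<and> y j \<in> insert c C then ?t y else y)" for y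
    proof (cases "y \<in> words ?M \<and> y j \<in> insert c C")
      case False
      then have "y \<noteq> ?a" "y \<noteq> ?b" using M by auto
      moreover have "q y = y" using False q(3) by auto
      ultimately show ?thesis using False by auto
    next
      case True
      show ?thesis
      proof (cases "y j = c")
        case False
        then have "q y = ?t y" using True q(3) by auto
        moreover have "?t y j = y j" using local_group_outside[OF t j] .
        then have "?t y \<noteq> ?a" "?t y \<noteq> ?b" using False by (metis fun_upd_same)+
        ultimately show ?thesis using True by simp
      next
        case yc: True
        then have "q y = y" using q(3) insert.hyps by auto
        moreover have "transposition ?a ?b y = ?t y"
        proof -
          \<comment> \<open>Words with letter \<open>c\<close> at \<open>j\<close> correspond to
            words on \<open>N\<close>, so comparing \<open>y\<close> with \<open>?a\<close> and
            \<open>?b\<close> reduces to comparing restrictions.\<close>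
          have ya: "restrict y N = r \<longleftrightarrow> y = r(j := c)" if "r \<in> words N" for r
          proof
            assume r: "restrict y N = r"
            show "y = r(j := c)"
            proof
              fix i
              consider "i = j" | "i \<in> N" | "i \<notin> ?M" by blast
              then show "y i = (r(j := c)) i"
              proof cases
                case 1
                then show ?thesis using yc by simp
              next
                case 2
                then show ?thesis using j fun_cong[OF r, of i] by auto
              next
                case 3
                then show ?thesis using that True by (simp add: words_iff)
              qed
            qed
          next
            have "restrict (r(j := c)) N = r" using that j by (auto simp: words_iff restrict_def)
            moreover assume "y = r(j := c)"
            ultimately show "restrict y N = r" by (simp only:)
          qed
          have eq: "?t y = (transposition a b (restrict y N))(j := c)"
            using yc j True permutes_wordsD[OF tp, of "restrict y N"]
            by (auto simp: local_perm_def fun_eq_iff words_iff)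
          consider "restrict y N = a" | "restrict y N = b" | "restrict y N \<noteq> a" "restrict y N \<noteq> b" by blast
          then show ?thesis
          proof cases
            case 1
            have "y = ?a" using 1 ya[OF ab(1)] by blast
            then show ?thesis unfolding eq 1 by simp
          next
            case 2
            have "y = ?b" using 2 ya[OF ab(2)] by blast
            then show ?thesis unfolding eq 2 by simp
          next
            case 3
            have "y = (restrict y N)(j := c)" using ya[OF restrict_in_words[of y N]] by blast
            then have "?t y = y" unfolding eq transpose_apply_other[OF 3] by (rule sym)
            moreover have "transposition ?a ?b y = y" using ya ab 3 by (intro transpose_apply_other) blast+
            ultimately show ?thesis by (simp only:)
          qed
        qed
        ultimately show ?thesis using True by simp
      qed
    qed
    moreover have "permutation ?q" using permutation_compose[OF permutation_swap_id q(1)] .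
    moreover have "evenperm ?q \<longleftrightarrow> even (card (insert c C))"
      using q(1,2) insert.hyps ne by (simp add: evenperm_comp permutation_swap_id evenperm_swap)
    ultimately show ?case by blast
  qed
  obtain q where q: "evenperm q \<longleftrightarrow> even CARD('a)" "\<And>y. q y = (if y \<in> words ?M then ?t y else y)"
    using partial[OF finite[of "UNIV :: 'a set"]] by auto
  then have "q = word_map ?M ?t" by (auto simp: word_map_def fun_eq_iff)
  then show ?thesis using q(1) by (simp add: even_on_def)
qed

text \<open>Decompose into transpositions; each becomes |A| many, so the sign is raised to the power
  |A|.\<close>

lemma even_on_insert:
  fixes f :: "'a::finite config \<Rightarrow> 'a config"
  assumes j: "j \<notin> N" and N: "finite N" and f: "f \<in> local_group N"
  shows "even_on (insert j N) f \<longleftrightarrow> even_on N f \<or> even CARD('a)"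
proof -
  have sub: "N \<subseteq> insert j N" and fin: "finite (insert j N)" using N by auto
  have "even_on (insert j N) (local_perm N p) \<longleftrightarrow> evenperm p \<or> even CARD('a)"
    if "p permutes words N" for p :: "'a config \<Rightarrow> 'a config"
    using that finite_words[OF N]
  proof (induction rule: permutes_induct)
    case id
    show ?case by (simp only: local_perm_id even_on_id evenperm_id simp_thms)
  next
    case (swap a b p)
    have t: "transposition a b permutes words N" using swap.hyps by (simp add: permutes_swap_id)
    have "permutation p" using permutes_imp_permutation[OF finite_words[OF N]] swap.hyps by blast
    then have ev: "evenperm (transposition a b \<circ> p) \<longleftrightarrow> \<not> evenperm p"
      using \<open>a \<noteq> b\<close> by (simp add: evenperm_comp permutation_swap_id evenperm_swap)
    have "local_perm N (transposition a b) \<in> local_group (insert j N)" "local_perm N p \<in> local_group (insert j N)"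
      using local_group_mono[OF sub] local_groupI t swap.hyps by blast+
    then show ?case
      using even_on_comp[OF fin] even_on_transposition_insert[OF j N] swap ev
      by (simp only: local_perm_comp) blast
  qed
  then show ?thesis using f unfolding even_on_def by (metis local_groupE)
qed

text \<open>Sites are added one at a time. For even |A| the first added site already makes
  \<open>f\<close> even, which explains the condition \<open>N \<noteq> M\<close>.\<close>

lemma even_on_mono:
  fixes f :: "'a::finite config \<Rightarrow> 'a config"
  assumes M: "finite M" "N \<subseteq> M" and f: "f \<in> local_group N"
  shows "even_on M f \<longleftrightarrow> even_on N f \<or> (even CARD('a) \<and> N \<noteq> M)"
proof -
  have N: "finite N" using M finite_subset by blast
  have step: "finite D \<Longrightarrow> D \<inter> N = {} \<Longrightarrow>
      even_on (D \<union> N) f \<longleftrightarrow> even_on N f \<or> (even CARD('a) \<and> D \<noteq> {})" for D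
  proof (induction D rule: finite_induct)
    case (insert j D)
    have "f \<in> local_group (D \<union> N)" using local_group_mono[OF _ f] by simp
    then have "even_on (insert j (D \<union> N)) f \<longleftrightarrow> even_on (D \<union> N) f \<or> even CARD('a)"
      using insert N by (intro even_on_insert) auto
    then show ?case using insert by auto
  qed simp
  have eq: "(M - N) \<union> N = M" "M - N \<noteq> {} \<longleftrightarrow> N \<noteq> M" using M by auto
  show ?thesis using step[OF finite_Diff[OF M(1)], of N] unfolding eq by blast
qed

section \<open>Translates\<close>

text \<open>The bijection \<open>b\<close> may move infinitely many points, as a shift does, so it
  has no sign of its own; instead each transposition of a decomposition of \<open>p\<close> is
  conjugated.\<close>

lemma evenperm_conj_bij:
  assumes b: "bij b" and S: "finite S" and p: "p permutes S"
  shows "permutation (b \<circ> p \<circ> inv_fun b) \<and> (evenperm (b \<circ> p \<circ> inv_fun b) \<longleftrightarrow> evenperm p)"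
  using p S
proof (induction rule: permutes_induct)
  case id
  have "b \<circ> id \<circ> inv_fun b = id" using b by (simp add: surj_iff[symmetric] bij_is_surj)
  then show ?case by (simp only: permutation_id evenperm_id simp_thms)
next
  case (swap x y p)
  have "b \<circ> (transposition x y \<circ> p) \<circ> inv_fun b = transposition (b x) (b y) \<circ> (b \<circ> p \<circ> inv_fun b)"
    using b by (simp add: fun_eq_iff Transposition.transpose_def bij_is_inj inj_eq)
  moreover have "b x \<noteq> b y" using b \<open>x \<noteq> y\<close> by (simp add: bij_is_inj inj_eq)
  moreover have "permutation p" using permutes_imp_permutation[OF S \<open>p permutes S\<close>] .
  ultimately show ?case
    using swap.IH \<open>x \<noteq> y\<close>
    by (simp only: permutation_compose permutation_swap_id evenperm_comp evenperm_swap simp_thms)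
qed

definition sh :: "int \<Rightarrow> 'a config \<Rightarrow> 'a config" where
  "sh n x = (\<lambda>i. x (i + n))"

lemma shift_eq_sh: "shift = sh 1"
  by (simp add: fun_eq_iff shift_def sh_def)

lemma sh_0: "sh 0 = id"
  by (simp add: fun_eq_iff sh_def)

lemma sh_add: "sh m \<circ> sh n = sh (m + n)"
  by (simp add: fun_eq_iff sh_def ac_simps)

lemma sh_sh [simp]: "sh m (sh n x) = sh (m + n) x"
  by (simp add: fun_eq_iff sh_def ac_simps)

lemma sh_0_apply [simp]: "sh 0 x = x"
  by (simp add: sh_def)

lemma bij_sh: "bij (sh n)"
  by (rule o_bij[of "sh (- n)"]) (simp_all add: sh_add sh_0)

lemma inv_sh: "inv_fun (sh n) = sh (- n)"
  by (rule inv_unique_comp) (simp_all add: sh_add sh_0)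

text \<open>Conjugation by the \<open>n\<close>-th power of the shift; it moves the window of a
  local map by \<open>-n\<close>.\<close>

definition translate :: "int \<Rightarrow> ('a config \<Rightarrow> 'a config) \<Rightarrow> 'a config \<Rightarrow> 'a config" where
  "translate n f = sh n \<circ> f \<circ> sh (- n)"

lemma translate_apply: "translate n f x i = f (sh (- n) x) (i + n)"
  by (simp add: translate_def sh_def)

lemma translate_translate: "translate m (translate n f) = translate (m + n) f"
  by (simp add: translate_def fun_eq_iff ac_simps)

lemma translate_0: "translate 0 f = f"
  by (simp add: translate_def sh_0)

lemma in_translated_window: "i \<in> (\<lambda>i. i - n) ` N \<longleftrightarrow> i + n \<in> N" for i n :: int
  by force

lemma translate_local_group:
  assumes f: "f \<in> local_group N"
  shows "translate n f \<in> local_group ((\<lambda>i. i - n) ` N)"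
proof -
  have "bij (translate n f)"
    unfolding translate_def using f by (intro bij_comp bij_sh bij_local_group)
  moreover have "translate n f x i = x i" if "i + n \<notin> N" for x i
    using local_group_outside[OF f that] by (simp add: translate_apply sh_def)
  moreover have "translate n f x i = translate n f y i"
    if "\<forall>i. i + n \<in> N \<longrightarrow> x i = y i" "i + n \<in> N" for x y i
    unfolding translate_apply
    by (rule local_group_cong[OF f _ that(2)]) (use that(1) in \<open>simp add: sh_def\<close>)
  ultimately show ?thesis
    unfolding local_group_iff Ball_def in_translated_window by blast
qed

lemma even_on_translate:
  fixes f :: "'a::finite config \<Rightarrow> 'a config"
  assumes N: "finite N" and f: "f \<in> local_group N"
  shows "even_on ((\<lambda>i. i - n) ` N) (translate n f) \<longleftrightarrow> even_on N f"
proof -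
  have "x \<in> words ((\<lambda>i. i - n) ` N) \<longleftrightarrow> sh (- n) x \<in> words N" for x :: "'a config"
  proof -
    have "x \<in> words ((\<lambda>i. i - n) ` N) \<longleftrightarrow> (\<forall>i. i + n \<notin> N \<longrightarrow> x i = undefined)"
      unfolding words_iff in_translated_window ..
    also have "\<dots> \<longleftrightarrow> (\<forall>i. i \<notin> N \<longrightarrow> x (i - n) = undefined)"
      using diff_add_cancel[of _ n] add_diff_cancel[of _ n] by (intro iffI allI impI) force+
    finally show ?thesis by (simp add: words_iff sh_def)
  qed
  then have "word_map ((\<lambda>i. i - n) ` N) (translate n f) = sh n \<circ> word_map N f \<circ> sh (- n)"
    by (auto simp: word_map_def translate_def fun_eq_iff)
  then show ?thesis
    using evenperm_conj_bij[OF bij_sh finite_words[OF N] word_map_permutes[OF f], of n]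
    by (simp add: even_on_def inv_sh)
qed

section \<open>Local and even local maps\<close>

text \<open>This set and \<open>even_maps\<close> turn out to be the carriers of \<open>G0'\<close>
  and \<open>G0''\<close>.\<close>

definition local_maps :: "('a config \<Rightarrow> 'a config) set" where
  "local_maps = {f. \<exists>N. finite N \<and> f \<in> local_group N}"

definition even_maps :: "('a config \<Rightarrow> 'a config) set" where
  "even_maps = {f. \<exists>N. finite N \<and> f \<in> local_group N \<and> even_on N f}"

text \<open>Two windows of \<open>f\<close> are compared through their union, so evenness can be
  tested on any one of them.\<close>

lemma even_maps_iff:
  fixes f :: "'a::finite config \<Rightarrow> 'a config"
  assumes M: "finite M" and f: "f \<in> local_group M"
  shows "f \<in> even_maps \<longleftrightarrow> even_on M f \<or> even CARD('a)"
proof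
  assume "f \<in> even_maps"
  then obtain N where N: "finite N" "f \<in> local_group N" "even_on N f" by (auto simp: even_maps_def)
  then have "even_on (N \<union> M) f" using even_on_mono[of "N \<union> M" N f] M by simp
  then show "even_on M f \<or> even CARD('a)" using even_on_mono[of "N \<union> M" M f] M f N by blast
next
  assume e: "even_on M f \<or> even CARD('a)"
  \<comment> \<open>For even |A|, one additional site makes any local map even.\<close>
  obtain j where j: "j \<notin> M" using ex_new_if_finite[OF infinite_UNIV_int M] by blast
  have "even_on (insert j M) f" using even_on_insert[OF j M f] e by simp
  moreover have "f \<in> local_group (insert j M)" using local_group_mono[OF _ f] by blast
  ultimately show "f \<in> even_maps" using M unfolding even_maps_def by blast
qed

lemma even_maps_subset: "even_maps \<subseteq> local_maps"
  by (auto simp: even_maps_def local_maps_def)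

lemma common_window:
  assumes "f \<in> local_maps" "g \<in> local_maps"
  obtains N where "finite N" "f \<in> local_group N" "g \<in> local_group N"
proof -
  obtain N M where "finite N" "f \<in> local_group N" "finite M" "g \<in> local_group M"
    using assms by (auto simp: local_maps_def)
  then show thesis
    using that[of "N \<union> M"] local_group_mono[of N "N \<union> M" f] local_group_mono[of M "N \<union> M" g] by simp
qed

lemma bij_local_maps: "f \<in> local_maps \<Longrightarrow> bij f"
  by (auto simp: local_maps_def bij_local_group)

lemma local_maps_comp: "f \<in> local_maps \<Longrightarrow> g \<in> local_maps \<Longrightarrow> f \<circ> g \<in> local_maps"
  by (erule (1) common_window) (auto simp: local_maps_def intro: local_group_comp)

lemma local_maps_inv: "f \<in> local_maps \<Longrightarrow> inv_fun f \<in> local_maps"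
  by (auto simp: local_maps_def intro: local_group_inv)

lemma local_maps_id: "id \<in> local_maps"
  using local_group_id[of "{}"] unfolding local_maps_def by blast

lemma local_maps_translate: "f \<in> local_maps \<Longrightarrow> translate n f \<in> local_maps"
  unfolding local_maps_def using translate_local_group by blast

text \<open>Not lying in \<open>even_maps\<close> behaves like a sign: a homomorphism to the group
  of order two, trivial when |A| is even.\<close>

lemma even_maps_comp_iff:
  fixes f g :: "'a::finite config \<Rightarrow> 'a config"
  assumes "f \<in> local_maps" "g \<in> local_maps"
  shows "f \<circ> g \<in> even_maps \<longleftrightarrow> (f \<in> even_maps \<longleftrightarrow> g \<in> even_maps)"
proof -
  obtain N where N: "finite N" "f \<in> local_group N" "g \<in> local_group N"
    using common_window[OF assms] .
  then show ?thesis
    using even_maps_iff[OF N(1) local_group_comp[OF N(2,3)]] even_maps_iff[OF N(1,2)]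
      even_maps_iff[OF N(1,3)] even_on_comp[OF N] by blast
qed

lemma even_maps_id: "id \<in> even_maps"
  using local_group_id[of "{}"] even_on_id unfolding even_maps_def by blast

lemma even_maps_comp:
  fixes f g :: "'a::finite config \<Rightarrow> 'a config"
  shows "f \<in> even_maps \<Longrightarrow> g \<in> even_maps \<Longrightarrow> f \<circ> g \<in> even_maps"
  using even_maps_comp_iff even_maps_subset by blast

lemma even_maps_inv_iff:
  fixes f :: "'a::finite config \<Rightarrow> 'a config"
  assumes "f \<in> local_maps"
  shows "inv_fun f \<in> even_maps \<longleftrightarrow> f \<in> even_maps"
proof -
  have "inv_fun f \<circ> f = id" using bij_local_maps[OF assms] by (simp add: bij_is_inj)
  then show ?thesis
    using even_maps_comp_iff[OF local_maps_inv[OF assms] assms] even_maps_id by metis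
qed

text \<open>The sign is invariant under conjugation by the shift, which is what places the
  commutators of \<open>G0\<close> in \<open>even_maps\<close>.\<close>

lemma even_maps_translate_iff:
  fixes f :: "'a::finite config \<Rightarrow> 'a config"
  assumes "f \<in> local_maps"
  shows "translate n f \<in> even_maps \<longleftrightarrow> f \<in> even_maps"
proof -
  obtain N where N: "finite N" "f \<in> local_group N" using assms by (auto simp: local_maps_def)
  then show ?thesis
    using even_maps_iff[OF _ translate_local_group[OF N(2)], of n] even_maps_iff[OF N]
      even_on_translate[OF N, of n] by simp
qed

lemma even_mapsI:
  fixes p :: "'a::finite config \<Rightarrow> 'a config"
  assumes "finite N" "p permutes words N" "evenperm p"
  shows "local_perm N p \<in> even_maps"
  using assms local_groupI[OF assms(2)] unfolding even_maps_def even_on_def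
  by (auto simp: word_map_local_perm)

text \<open>Subgroups in terms of plain composition and inverse functions, meant for sets of
  bijections; \<open>subgroup_homeos_iff\<close> links this to the algebraic notion.\<close>

definition map_group :: "('b \<Rightarrow> 'b) set \<Rightarrow> bool" where
  "map_group H \<longleftrightarrow> id \<in> H \<and> (\<forall>f\<in>H. \<forall>g\<in>H. f \<circ> g \<in> H) \<and> (\<forall>f\<in>H. inv_fun f \<in> H)"

lemma map_groupD:
  assumes "map_group H"
  shows "id \<in> H" "f \<in> H \<Longrightarrow> g \<in> H \<Longrightarrow> f \<circ> g \<in> H" "f \<in> H \<Longrightarrow> inv_fun f \<in> H"
  using assms by (auto simp: map_group_def)

text \<open>Pulls a group of maps back to permutations of the words of one window, where the
  three-cycle lemmas apply.\<close>

lemma map_group_words: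
  assumes "map_group H"
  shows "map_group {p. p permutes words M \<and> local_perm M p \<in> H}" (is "map_group ?G")
  unfolding map_group_def
proof (intro conjI ballI)
  show "id \<in> ?G" using map_groupD(1)[OF assms] permutes_id by (simp only: mem_Collect_eq local_perm_id simp_thms)
  show "p \<circ> q \<in> ?G" if "p \<in> ?G" "q \<in> ?G" for p q
    using that map_groupD(2)[OF assms] by (auto simp: local_perm_comp permutes_compose)
  show "inv_fun p \<in> ?G" if "p \<in> ?G" for p
    using that map_groupD(3)[OF assms] by (auto simp: inv_local_perm[symmetric] permutes_inv)
qed

lemma card_words_ge:
  assumes "CARD('a::finite) \<ge> 2" "finite N" "k \<le> card N"
  shows "2 ^ k \<le> card (words N :: 'a config set)"
proof -
  have "2 ^ k \<le> CARD('a) ^ k" using assms by (intro power_mono) auto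
  also have "\<dots> \<le> CARD('a) ^ card N" using assms by (intro power_increasing) auto
  finally show ?thesis using assms by (simp add: card_words)
qed

lemma ex_other_symbol:
  assumes "CARD('a) \<ge> 2"
  obtains b :: 'a where "b \<noteq> a"
proof -
  have "\<not> (UNIV :: 'a set) \<subseteq> {a}"
    using assms card_mono[of "{a}" "UNIV :: 'a set"] by auto
  then show thesis using that by auto
qed

lemma words_eqI: "x \<in> words N \<Longrightarrow> y \<in> words N \<Longrightarrow> (\<And>i. i \<in> N \<Longrightarrow> x i = y i) \<Longrightarrow> x = y"
  unfolding words_iff by (rule ext) metis

lemma restrict_eq_iff: "restrict x N = restrict y N \<longleftrightarrow> (\<forall>i\<in>N. x i = y i)"
  by (auto simp: restrict_def fun_eq_iff)

section \<open>Three-cycles of words, and windows of growing length\<close>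

lemma local_cyc3:
  assumes "x \<in> words N" "y \<in> words N" "z \<in> words N" "distinct [x, y, z]"
  shows "local_perm N (cyc3 x y z) \<in> local_group N" "even_on N (local_perm N (cyc3 x y z))"
proof -
  have "cyc3 x y z permutes words N" using cyc3_permutes[OF assms(1-3)] .
  then show "local_perm N (cyc3 x y z) \<in> local_group N" "even_on N (local_perm N (cyc3 x y z))"
    using evenperm_cyc3[OF assms(4)] by (auto simp: local_groupI even_on_def word_map_local_perm)
qed

lemma local_cyc3_fixed:
  assumes "distinct [x, y, z]" "restrict t N \<notin> {x, y, z}"
  shows "local_perm N (cyc3 x y z) t = t"
proof -
  have "cyc3 x y z (restrict t N) = restrict t N"
    using assms(2) unfolding cyc3_apply[OF assms(1)] by auto
  then show ?thesis by (simp add: local_perm_def fun_eq_iff)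
qed

lemma local_cyc3_first:
  assumes "distinct [restrict x N, restrict y N, z]" "\<And>i. i \<notin> N \<Longrightarrow> x i = y i"
  shows "local_perm N (cyc3 (restrict x N) (restrict y N) z) x = y"
proof -
  have "cyc3 (restrict x N) (restrict y N) z (restrict x N) = restrict y N"
    unfolding cyc3_apply[OF assms(1)] by (rule if_P) (rule refl)
  then show ?thesis using assms(2) by (simp add: local_perm_def fun_eq_iff)
qed

text \<open>
  The three-cycle on the long window \<open>{0..n}\<close> is the commutator of a three-cycle on \<open>{0..<n}\<close>
  and one on \<open>{1..n}\<close> whose supports meet in the single word \<open>x\<close>.
\<close>
lemma cyc3_from_overlapping_windows:
  fixes H :: "('a::finite config \<Rightarrow> 'a config) set" and n :: int
  assumes A: "CARD('a) \<ge> 2" and H: "map_group H" and n: "n \<ge> 3"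
    and left: "\<And>f. f \<in> local_group {0..<n} \<Longrightarrow> even_on {0..<n} f \<Longrightarrow> f \<in> H"
    and right: "\<And>f. f \<in> local_group {1..<n+1} \<Longrightarrow> even_on {1..<n+1} f \<Longrightarrow> f \<in> H"
    and xyz: "x \<in> words {0..<n+1}" "y \<in> words {0..<n+1}" "z \<in> words {0..<n+1}"
    and ends: "y n = x n" "z 0 = x 0"
    and mid: "distinct [restrict x {1..<n}, restrict y {1..<n}, restrict z {1..<n}]"
  shows "distinct [x, y, z]" "local_perm {0..<n+1} (cyc3 x y z) \<in> H"
proof -
  let ?M = "{0..<n+1}" and ?L = "{0..<n}" and ?R = "{1..<n+1}" and ?D = "{1..<n}"
  show "distinct [x, y, z]" using mid by auto
  \<comment> \<open>The third points \<open>?w\<close> and \<open>?v\<close> of the two short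
    three-cycles differ from \<open>y\<close> and \<open>z\<close> only at one end of the window, so
    they have the same middle part on \<open>?D\<close>.\<close>
  obtain c where c: "c \<noteq> y 0" using ex_other_symbol[OF A] by blast
  obtain d where d: "d \<noteq> z n" using ex_other_symbol[OF A] by blast
  let ?w = "y(0 := c)" and ?v = "z(n := d)"
  have DL: "restrict s ?D = restrict t ?D" if "restrict s ?L = restrict t ?L" for s t :: "'a config"
    using that unfolding restrict_eq_iff by auto
  have DR: "restrict s ?D = restrict t ?D" if "restrict s ?R = restrict t ?R" for s t :: "'a config"
    using that unfolding restrict_eq_iff by auto
  have w: "restrict ?w ?D = restrict y ?D" and v: "restrict ?v ?D = restrict z ?D"
    by (auto simp: restrict_eq_iff)
  have "?w 0 \<noteq> y 0" using c by simp
  moreover have "0 \<in> ?L" using n by simp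
  ultimately have wy: "restrict ?w ?L \<noteq> restrict y ?L" unfolding restrict_eq_iff by blast
  have "?v n \<noteq> z n" using d by simp
  moreover have "n \<in> ?R" using n by simp
  ultimately have vz: "restrict ?v ?R \<noteq> restrict z ?R" unfolding restrict_eq_iff by blast
  have dL: "distinct [restrict x ?L, restrict y ?L, restrict ?w ?L]"
    using mid DL[of x y] DL[of x ?w] w wy by auto
  have dR: "distinct [restrict x ?R, restrict z ?R, restrict ?v ?R]"
    using mid DR[of x z] DR[of x ?v] v vz by auto
  define f where "f = local_perm ?L (cyc3 (restrict x ?L) (restrict y ?L) (restrict ?w ?L))"
  define g where "g = local_perm ?R (cyc3 (restrict x ?R) (restrict z ?R) (restrict ?v ?R))"
  have f: "f \<in> local_group ?L" "even_on ?L f" and g: "g \<in> local_group ?R" "even_on ?R g"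
    unfolding f_def g_def
    using local_cyc3[OF restrict_in_words restrict_in_words restrict_in_words dL]
      local_cyc3[OF restrict_in_words restrict_in_words restrict_in_words dR] by blast+
  have fM: "f \<in> local_group ?M" and gM: "g \<in> local_group ?M"
    using local_group_mono[OF _ f(1), of ?M] local_group_mono[OF _ g(1), of ?M] by auto
  \<comment> \<open>\<open>f\<close> cannot change site \<open>n\<close>, which is harmless because
    \<open>y n = x n\<close>; symmetrically for \<open>g\<close> at site \<open>0\<close>.\<close>
  have fx: "f x = y"
    unfolding f_def
  proof (rule local_cyc3_first[OF dL])
    show "x i = y i" if "i \<notin> ?L" for i
    proof (cases "i = n")
      case False
      then have "i \<notin> ?M" using that by auto
      then show ?thesis using xyz unfolding words_iff by metis
    qed (simp add: ends)
  qed
  have gx: "g x = z"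
    unfolding g_def
  proof (rule local_cyc3_first[OF dR])
    show "x i = z i" if "i \<notin> ?R" for i
    proof (cases "i = 0")
      case False
      then have "i \<notin> ?M" using that by auto
      then show ?thesis using xyz unfolding words_iff by metis
    qed (simp add: ends)
  qed
  let ?f = "word_map ?M f" and ?g = "word_map ?M g"
  have bij: "bij ?f" "bij ?g" using word_map_permutes fM gM permutes_bij by blast+
  \<comment> \<open>If both maps move \<open>t\<close>, its middle part is that of \<open>x\<close>
    or \<open>y\<close> because of \<open>f\<close>, and that of \<open>x\<close> or
    \<open>z\<close> because of \<open>g\<close>. Hence it is that of \<open>x\<close>, and then
    \<open>t\<close> agrees with \<open>x\<close> on both windows.\<close>
  have "?f t = t \<or> ?g t = t" if "t \<noteq> x" for t
  proof (rule ccontr)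
    assume neg: "\<not> (?f t = t \<or> ?g t = t)"
    then have t: "t \<in> words ?M" "f t \<noteq> t" "g t \<noteq> t" by (auto simp: word_map_def split: if_splits)
    have L: "restrict t ?L \<in> {restrict x ?L, restrict y ?L, restrict ?w ?L}"
      using t(2) local_cyc3_fixed[OF dL] unfolding f_def by blast
    have R: "restrict t ?R \<in> {restrict x ?R, restrict z ?R, restrict ?v ?R}"
      using t(3) local_cyc3_fixed[OF dR] unfolding g_def by blast
    have xy: "restrict x ?D \<noteq> restrict y ?D" and xz: "restrict x ?D \<noteq> restrict z ?D"
      and yz: "restrict y ?D \<noteq> restrict z ?D" using mid by simp_all
    have L': "restrict t ?L = restrict x ?L \<or> restrict t ?D = restrict y ?D"
      using L DL[of t y] DL[of t ?w] unfolding w insert_iff by blast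
    have R': "restrict t ?R = restrict x ?R \<or> restrict t ?D = restrict z ?D"
      using R DR[of t z] DR[of t ?v] unfolding v insert_iff by blast
    have "restrict t ?L = restrict x ?L \<and> restrict t ?R = restrict x ?R"
      using L' R' DL[of t x] DR[of t x] xy xz yz by metis
    moreover have "?M = ?L \<union> ?R" using n by auto
    ultimately have "t = x" using words_eqI[OF t(1) xyz(1)] unfolding restrict_eq_iff by (metis UnE)
    then show False using that by simp
  qed
  moreover have "?f x = y" "?g x = z" using fx gx xyz by (simp_all add: word_map_def)
  moreover have "y \<noteq> x" "z \<noteq> x" using mid by auto
  ultimately have "?f \<circ> ?g \<circ> inv_fun ?f \<circ> inv_fun ?g = cyc3 x y z"
    using commutator_cyc3(2)[OF bij, of x] by metis
  moreover have "local_perm ?M (?f \<circ> ?g \<circ> inv_fun ?f \<circ> inv_fun ?g) = f \<circ> g \<circ> inv_fun f \<circ> inv_fun g"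
  proof -
    have pf: "?f permutes words ?M" and pg: "?g permutes words ?M"
      using word_map_permutes fM gM by blast+
    have "local_perm ?M ?f = f" "local_perm ?M ?g = g" using fM gM by (metis local_groupE)+
    then show ?thesis
      using inv_local_perm[OF pf] inv_local_perm[OF pg]
      by (simp only: local_perm_comp[OF permutes_inv[OF pg]] local_perm_comp[OF permutes_inv[OF pf]]
          local_perm_comp[OF pg])
  qed
  ultimately show "local_perm ?M (cyc3 x y z) \<in> H"
    using map_groupD[OF H] left[OF f] right[OF g] by metis
qed

text \<open>The overlap construction links words that agree at one end and differ in the middle.
  Such links connect all words of the longer window, so \<open>cyc3_mem_of_linked\<close> supplies
  every three-cycle there.\<close>

lemma even_maps_longer_window:
  fixes H :: "('a::finite config \<Rightarrow> 'a config) set" and n :: int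
  assumes A: "CARD('a) \<ge> 2" and H: "map_group H" and n: "n \<ge> 3"
    and left: "\<And>f. f \<in> local_group {0..<n} \<Longrightarrow> even_on {0..<n} f \<Longrightarrow> f \<in> H"
    and right: "\<And>f. f \<in> local_group {1..<n+1} \<Longrightarrow> even_on {1..<n+1} f \<Longrightarrow> f \<in> H"
    and f: "f \<in> local_group {0..<n+1}" "even_on {0..<n+1} f"
  shows "f \<in> H"
proof -
  let ?M = "{0..<n+1}" and ?D = "{1..<n}"
  define G where "G = {p. p permutes words ?M \<and> local_perm ?M p \<in> H}"
  note G = map_groupD[OF map_group_words[OF H, of ?M, folded G_def]]
  have bijG: "bij p" if "p \<in> G" for p using that permutes_bij unfolding G_def by blast
  define R where "R x y \<longleftrightarrow> (\<exists>z. distinct [x, y, z] \<and> cyc3 x y z \<in> G)" for x y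
  have cycG: "distinct [x, y, z] \<and> cyc3 x y z \<in> G"
    if "x \<in> words ?M" "y \<in> words ?M" "z \<in> words ?M" "y n = x n" "z 0 = x 0"
      "distinct [restrict x ?D, restrict y ?D, restrict z ?D]" for x y z
    using cyc3_from_overlapping_windows[OF A H n left right that] cyc3_permutes[OF that(1-3)]
    unfolding G_def by blast
  \<comment> \<open>Since \<open>n \<ge> 3\<close>, the middle has at least two sites and hence four
    words, so one of them avoids any two given middle parts.\<close>
  have fresh: "\<exists>m\<in>words ?D. m \<noteq> restrict x ?D \<and> m \<noteq> restrict y ?D" for x y :: "'a config"
  proof (rule ccontr)
    assume "\<not> ?thesis"
    then have "words ?D \<subseteq> {restrict x ?D, restrict y ?D}" by blast
    moreover have "card {restrict x ?D, restrict y ?D} \<le> 2"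
      by (cases "restrict x ?D = restrict y ?D") simp_all
    ultimately have "card (words ?D :: 'a config set) \<le> 2"
      using card_mono[of "{restrict x ?D, restrict y ?D}" "words ?D"] by simp
    moreover have "2 ^ 2 \<le> card (words ?D :: 'a config set)"
      using card_words_ge[OF A, of ?D 2] n by simp
    ultimately show False by simp
  qed
  have glue: "\<exists>u\<in>words ?M. u n = b \<and> u 0 = a \<and> restrict u ?D = m" if "m \<in> words ?D" for a b m
  proof -
    let ?u = "\<lambda>i. if i = n then b else if i = 0 then a else m i"
    have "?u \<in> words ?M" "restrict ?u ?D = m"
      using that n by (auto simp: words_iff restrict_def fun_eq_iff)
    then show ?thesis using n by (intro bexI[of _ ?u]) auto
  qed
  have R_left: "R x y" if xy: "x \<in> words ?M" "y \<in> words ?M" "y n = x n" "restrict x ?D \<noteq> restrict y ?D" for x y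
  proof -
    obtain m where m: "m \<in> words ?D" "m \<noteq> restrict x ?D" "m \<noteq> restrict y ?D" using fresh by blast
    obtain z where z: "z \<in> words ?M" "z 0 = x 0" "restrict z ?D = m" using glue[OF m(1)] by blast
    have "distinct [restrict x ?D, restrict y ?D, restrict z ?D]" using m z xy by auto
    then show ?thesis using cycG[OF xy(1,2) z(1) xy(3) z(2)] unfolding R_def by blast
  qed
  have R_right: "R x z" if xz: "x \<in> words ?M" "z \<in> words ?M" "z 0 = x 0" "restrict x ?D \<noteq> restrict z ?D" for x z
  proof -
    obtain m where m: "m \<in> words ?D" "m \<noteq> restrict x ?D" "m \<noteq> restrict z ?D" using fresh by blast
    obtain y where y: "y \<in> words ?M" "y n = x n" "restrict y ?D = m" using glue[OF m(1)] by blast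
    have "distinct [restrict x ?D, restrict y ?D, restrict z ?D]" using m y xz by auto
    then have c: "distinct [x, y, z]" "cyc3 x y z \<in> G" using cycG[OF xz(1) y(1) xz(2) y(2) xz(3)] by auto
    \<comment> \<open>The cycle runs from \<open>z\<close> to \<open>x\<close>; its rotation is
      inverted to obtain one from \<open>x\<close> to \<open>z\<close>.\<close>
    have "cyc3 y z x \<in> G" using c cyc3_rotate by metis
    moreover have "distinct [y, z, x]" "distinct [x, z, y]" using c(1) by auto
    ultimately show ?thesis using G(3) inv_cyc3 unfolding R_def by metis
  qed
  have linked: "R\<^sup>*\<^sup>* x y" if xy: "x \<in> words ?M" "y \<in> words ?M" for x y
  proof -
    obtain m where m: "m \<in> words ?D" "m \<noteq> restrict x ?D" "m \<noteq> restrict y ?D" using fresh by blast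
    \<comment> \<open>\<open>u\<close> has the right end of \<open>x\<close>, the left end of
      \<open>y\<close> and a middle different from both, so a step on the left window and then one
      on the right window join \<open>x\<close> to \<open>y\<close>.\<close>
    obtain u where u: "u \<in> words ?M" "u n = x n" "u 0 = y 0" "restrict u ?D = m" using glue[OF m(1)] by blast
    have "R x u" using R_left[OF xy(1) u(1,2)] u(4) m by metis
    moreover have "R u y" using R_right[OF u(1) xy(2) u(3)[symmetric]] u(4) m by metis
    ultimately show ?thesis by simp
  qed
  have "word_map ?M f \<in> G"
  proof (rule even_permutes_in[where S = "words ?M"])
    show "cyc3 x y z \<in> G" if "x \<in> words ?M" "y \<in> words ?M" "z \<in> words ?M" "distinct [x, y, z]" for x y z
      using cyc3_mem_of_linked[of G "words ?M", OF bijG G(2,3) linked[unfolded R_def] that] .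
  qed (use f G finite_words word_map_permutes in \<open>auto simp: even_on_def\<close>)
  then show ?thesis using f(1) unfolding G_def by (metis (mono_tags, lifting) local_groupE mem_Collect_eq)
qed

section \<open>Generation by the shift and the window of length three\<close>

lemma sh_mem:
  assumes "map_group H" "shift \<in> H"
  shows "sh n \<in> H"
proof -
  have nat: "sh (int k) \<in> H" for k
  proof (induction k)
    case 0
    show ?case using map_groupD(1)[OF assms(1)] by (simp only: of_nat_0 sh_0)
  next
    case (Suc k)
    have "sh (int (Suc k)) = shift \<circ> sh (int k)" unfolding shift_eq_sh sh_add by simp
    then show ?case using map_groupD(2)[OF assms(1) assms(2) Suc] by metis
  qed
  show ?thesis
  proof (cases "n \<ge> 0")
    case True
    then show ?thesis using nat[of "nat n"] by simp
  next
    case False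
    have "inv_fun (sh (int (nat (- n)))) = sh n" unfolding inv_sh using False by simp
    then show ?thesis using map_groupD(3)[OF assms(1) nat] by metis
  qed
qed

lemma translate_mem_iff:
  assumes "map_group H" "shift \<in> H"
  shows "translate n f \<in> H \<longleftrightarrow> f \<in> H"
proof -
  have "translate m g \<in> H" if "g \<in> H" for m g
    unfolding translate_def using that sh_mem[OF assms] map_groupD(2)[OF assms(1)] by blast
  from this[of f n] this[of "translate n f" "- n"] show ?thesis
    by (auto simp: translate_translate translate_0)
qed

text \<open>Induction on the length of the window: \<open>{1..<n+1}\<close> is a translate of
  \<open>{0..<n}\<close>, so the shift supplies the second of the two overlapping windows. An
  arbitrary window is put into an interval and translated to start at \<open>0\<close>.\<close>

lemma even_maps_generated:
  fixes H :: "('a::finite config \<Rightarrow> 'a config) set"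
  assumes A: "CARD('a) \<ge> 2" and H: "map_group H" "shift \<in> H" "local_group {0..<3} \<subseteq> H"
  shows "even_maps \<subseteq> H"
proof
  have window: "f \<in> H" if "3 \<le> n" "f \<in> local_group {0..<n}" "even_on {0..<n} f" for n :: int and f
    using that
  proof (induction n arbitrary: f rule: int_ge_induct)
    case base
    then show ?case using H(3) by blast
  next
    case (step n)
    have "g \<in> H" if g: "g \<in> local_group {1..<n+1}" "even_on {1..<n+1} g" for g
    proof -
      have im: "(\<lambda>i. i - 1) ` {1..<n+1} = {0..<n}"
        unfolding Set.set_eq_iff in_translated_window by auto
      have "translate 1 g \<in> H"
        using step.IH translate_local_group[OF g(1), of 1] even_on_translate[OF _ g(1), of 1] g(2)
        unfolding im by simp
      then show ?thesis using translate_mem_iff[OF H(1,2)] by blast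
    qed
    then show ?case using even_maps_longer_window[OF A H(1) step.hyps step.IH _ step.prems] by blast
  qed
  fix f :: "'a config \<Rightarrow> 'a config" assume "f \<in> even_maps"
  then obtain N where N: "finite N" "f \<in> local_group N" "even_on N f" by (auto simp: even_maps_def)
  \<comment> \<open>The extra entries \<open>0\<close> and \<open>a + 3\<close> make the extrema
    exist for empty \<open>N\<close> and force the length to be at least three; \<open>+ 1\<close>
    is due to the half-open interval.\<close>
  define a where "a = Min (insert 0 N)"
  define n where "n = Max (insert (a + 3) N) + 1 - a"
  have "N \<subseteq> {a..<a+n}"
  proof
    fix i assume i: "i \<in> N"
    have "a \<le> i" "i \<le> Max (insert (a + 3) N)" using N i unfolding a_def by simp_all
    then show "i \<in> {a..<a+n}" by (simp add: n_def)
  qed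
  then have M: "f \<in> local_group {a..<a+n}" "even_on {a..<a+n} f"
    using local_group_mono[OF _ N(2)] even_on_mono[OF _ _ N(2), of "{a..<a+n}"] N(3) by auto
  have im: "(\<lambda>i. i - a) ` {a..<a+n} = {0..<n}"
    unfolding Set.set_eq_iff in_translated_window by auto
  have "a + 3 \<le> Max (insert (a + 3) N)" using N by simp
  then have n: "3 \<le> n" by (simp add: n_def)
  have "translate a f \<in> H"
    using window[OF n] translate_local_group[OF M(1), of a] even_on_translate[OF _ M(1), of a] M(2)
    unfolding im by simp
  then show "f \<in> H" using translate_mem_iff[OF H(1,2)] by blast
qed

text \<open>Even maps have index at most two. If some local map is not even then |A| is odd, and a
  transposition of words on \<open>{0..<3}\<close> represents the other coset.\<close>

lemma local_maps_generated:
  fixes H :: "('a::finite config \<Rightarrow> 'a config) set"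
  assumes A: "CARD('a) \<ge> 2" and H: "map_group H" "shift \<in> H" "local_group {0..<3} \<subseteq> H"
  shows "local_maps \<subseteq> H"
proof
  fix f :: "'a config \<Rightarrow> 'a config" assume f: "f \<in> local_maps"
  have E: "even_maps \<subseteq> H" by (rule even_maps_generated[OF assms])
  show "f \<in> H"
  proof (cases "f \<in> even_maps")
    case True
    then show ?thesis using E by blast
  next
    case False
    have odd: "\<not> even CARD('a)"
      using False f even_maps_iff unfolding local_maps_def by blast
    have "2 ^ 3 \<le> card (words {0..<3} :: 'a config set)" by (rule card_words_ge[OF A]) auto
    then have "\<not> card (words {0..<3} :: 'a config set) \<le> Suc 0" by simp
    then obtain u v :: "'a config" where uv: "u \<in> words {0..<3}" "v \<in> words {0..<3}" "u \<noteq> v"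
      using card_le_Suc0_iff_eq[OF finite_words[of "{0..<3}"]] by auto
    define t where "t = local_perm {0..<3} (transposition u v)"
    have p: "transposition u v permutes words {0..<3}" using uv by (simp add: permutes_swap_id)
    have t: "t \<in> local_group {0..<3}" unfolding t_def using local_groupI[OF p] .
    have "\<not> even_on {0..<3} t"
      unfolding even_on_def t_def word_map_local_perm[OF p] using uv by (simp add: evenperm_swap)
    then have tE: "t \<notin> even_maps" using even_maps_iff[OF _ t] odd by simp
    have tl: "t \<in> local_maps" using t unfolding local_maps_def by blast
    have "f \<circ> t \<in> H" using even_maps_comp_iff[OF f tl] False tE E by blast
    moreover have "inv_fun t \<in> H" using t H map_groupD(3) by blast
    moreover have "f = (f \<circ> t) \<circ> inv_fun t"
      using bij_local_group[OF t] by (simp add: fun_eq_iff bij_is_surj surj_f_inv_f)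
    ultimately show ?thesis using map_groupD(2)[OF H(1)] by metis
  qed
qed

text \<open>For five distinct words, the supports of (x, y, u) and (x, z, v) meet only in
  \<open>x\<close>, so their commutator is (x, y, z). Thus \<open>even_maps\<close> is
  perfect.\<close>

lemma even_maps_subset_commutators:
  fixes H :: "('a::finite config \<Rightarrow> 'a config) set"
  assumes A: "CARD('a) \<ge> 2" and H: "map_group H"
    and comm: "\<And>f g. f \<in> even_maps \<Longrightarrow> g \<in> even_maps \<Longrightarrow> f \<circ> g \<circ> inv_fun f \<circ> inv_fun g \<in> H"
  shows "even_maps \<subseteq> H"
proof
  fix f :: "'a config \<Rightarrow> 'a config" assume "f \<in> even_maps"
  then obtain N where N: "finite N" "f \<in> local_group N" "even_on N f" by (auto simp: even_maps_def)
  \<comment> \<open>Three sites guarantee at least eight words, so \<open>u\<close> and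
    \<open>v\<close> can be found; enlarging the window preserves evenness.\<close>
  define M where "M = N \<union> {0..<3}"
  have M: "finite M" "f \<in> local_group M" "even_on M f"
    using N local_group_mono[of N M f] even_on_mono[of M N f] by (auto simp: M_def)
  have "card {0..<3::int} \<le> card M" using M(1) by (intro card_mono) (auto simp: M_def)
  then have c: "2 ^ 3 \<le> card (words M :: 'a config set)" by (intro card_words_ge[OF A M(1)]) auto
  define G where "G = {p. p permutes words M \<and> local_perm M p \<in> H}"
  note G = map_groupD[OF map_group_words[OF H, of M, folded G_def]]
  have cyc: "cyc3 x y z \<in> G"
    if S: "x \<in> words M" "y \<in> words M" "z \<in> words M" and d: "distinct [x, y, z]" for x y z
  proof -
    have "card (words M - {x, y, z}) = card (words M :: 'a config set) - 3"
      using S d by (subst card_Diff_subset) auto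
    then have "\<not> card (words M - {x, y, z}) \<le> Suc 0" using c by simp
    then obtain u v where uv: "u \<in> words M - {x, y, z}" "v \<in> words M - {x, y, z}" "u \<noteq> v"
      using card_le_Suc0_iff_eq[OF finite_Diff[OF finite_words[OF M(1)]]] by blast
    have d1: "distinct [x, y, u]" and d2: "distinct [x, z, v]" using uv d by auto
    let ?f = "cyc3 x y u" and ?g = "cyc3 x z v"
    have pf: "?f permutes words M" and pg: "?g permutes words M"
      using cyc3_permutes[of x "words M" y u] cyc3_permutes[of x "words M" z v] S uv by auto
    have "?f x = y" "?g x = z" using cyc3_apply[OF d1, of x] cyc3_apply[OF d2, of x] by simp_all
    moreover have "?f t = t \<or> ?g t = t" if "t \<noteq> x" for t
      using cyc3_apply[OF d1, of t] cyc3_apply[OF d2, of t] that d uv by auto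
    moreover have "y \<noteq> x" "z \<noteq> x" using d by auto
    ultimately have "?f \<circ> ?g \<circ> inv_fun ?f \<circ> inv_fun ?g = cyc3 x y z"
      using commutator_cyc3(2)[OF permutes_bij[OF pf] permutes_bij[OF pg], of x] by metis
    moreover have "local_perm M (?f \<circ> ?g \<circ> inv_fun ?f \<circ> inv_fun ?g) =
        local_perm M ?f \<circ> local_perm M ?g \<circ> inv_fun (local_perm M ?f) \<circ> inv_fun (local_perm M ?g)"
      unfolding inv_local_perm[OF pf] inv_local_perm[OF pg]
      by (simp only: local_perm_comp[OF permutes_inv[OF pg]] local_perm_comp[OF permutes_inv[OF pf]]
          local_perm_comp[OF pg])
    moreover have "local_perm M ?f \<in> even_maps" "local_perm M ?g \<in> even_maps"
      using even_mapsI[OF M(1) pf evenperm_cyc3[OF d1]] even_mapsI[OF M(1) pg evenperm_cyc3[OF d2]] .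
    ultimately have "local_perm M (cyc3 x y z) \<in> H"
      using comm[of "local_perm M ?f" "local_perm M ?g"] by metis
    then show ?thesis unfolding G_def using cyc3_permutes[OF S] by blast
  qed
  have "word_map M f \<in> G"
    by (rule even_permutes_in[OF finite_words[OF M(1)] G(1,2) cyc word_map_permutes[OF M(2)]])
      (use M(3) in \<open>simp_all add: even_on_def\<close>)
  then show "f \<in> H" using M(2) unfolding G_def by (metis (mono_tags, lifting) local_groupE mem_Collect_eq)
qed

text \<open>
  Coordinates outside the window of \<open>h\<close> provide parallel copies \<open>x, y, z\<close> of a moved word, so that
  \<open>x, y, z, h x, h y, h z\<close> are distinct.
\<close>
lemma even_maps_minimal:
  fixes K :: "('a::finite config \<Rightarrow> 'a config) set"
  assumes A: "CARD('a) \<ge> 2" and K: "map_group K" "K \<subseteq> even_maps"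
    and conj: "\<And>k c. k \<in> K \<Longrightarrow> c \<in> even_maps \<Longrightarrow> c \<circ> k \<circ> inv_fun c \<in> K"
    and h: "h \<in> K" "h \<noteq> id"
  shows "even_maps \<subseteq> K"
proof
  fix f :: "'a config \<Rightarrow> 'a config" assume "f \<in> even_maps"
  then obtain N' where N': "finite N'" "f \<in> local_group N'" "even_on N' f" by (auto simp: even_maps_def)
  obtain N where N: "finite N" "h \<in> local_group N" using h K by (auto simp: even_maps_def)
  \<comment> \<open>Two sites that \<open>h\<close> neither reads nor changes.\<close>
  obtain j1 where j1: "j1 \<notin> N" using ex_new_if_finite[OF infinite_UNIV_int N(1)] by blast
  obtain j2 where j2: "j2 \<notin> insert j1 N"
    using ex_new_if_finite[OF infinite_UNIV_int, of "insert j1 N"] N(1) by blast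
  define M where "M = N \<union> N' \<union> {j1, j2} \<union> {0..<3}"
  have M: "finite M" "N \<subseteq> M" "N' \<subseteq> M" "j1 \<in> M" "j2 \<in> M" using N N' by (auto simp: M_def)
  have fM: "f \<in> local_group M" "even_on M f"
    using N' M local_group_mono[of N' M f] even_on_mono[of M N' f] by auto
  have hM: "h \<in> local_group M" using local_group_mono[OF M(2) N(2)] .
  have "card {0..<3::int} \<le> card M" using M(1) by (intro card_mono) (auto simp: M_def)
  then have c: "2 ^ 3 \<le> card (words M :: 'a config set)" by (intro card_words_ge[OF A M(1)]) auto
  define G where "G = {p. p permutes words M \<and> local_perm M p \<in> K}"
  note G = map_groupD[OF map_group_words[OF K(1), of M, folded G_def]]
  \<comment> \<open>On the words of \<open>M\<close>, conjugation by an even permutation is induced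
    by conjugation by an even map.\<close>
  interpret even_conj_closed "words M" G
  proof
    show "finite (words M :: 'a config set)" by (rule finite_words[OF M(1)])
    show "k permutes words M" if "k \<in> G" for k using that by (simp add: G_def)
    show "k \<circ> l \<in> G" if "k \<in> G" "l \<in> G" for k l by (rule G(2)[OF that])
    show "inv_fun k \<in> G" if "k \<in> G" for k by (rule G(3)[OF that])
    show "c \<circ> k \<circ> inv_fun c \<in> G" if k: "k \<in> G" and c: "c permutes words M" "evenperm c" for k c
    proof -
      have kp: "k permutes words M" "local_perm M k \<in> K" using k by (simp_all add: G_def)
      have "local_perm M c \<circ> local_perm M k \<circ> inv_fun (local_perm M c) \<in> K"
        using conj[OF kp(2) even_mapsI[OF M(1) c]] .
      moreover have "local_perm M (c \<circ> k \<circ> inv_fun c)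
          = local_perm M c \<circ> local_perm M k \<circ> inv_fun (local_perm M c)"
        unfolding inv_local_perm[OF c(1)]
        by (simp only: local_perm_comp[OF permutes_inv[OF c(1)]] local_perm_comp[OF kp(1)])
      moreover have "c \<circ> k \<circ> inv_fun c permutes words M"
        by (intro permutes_compose permutes_inv c(1) kp(1))
      ultimately show ?thesis by (simp add: G_def)
    qed
  qed
  have hid: "local_perm M (word_map M h) = h" using hM by (metis local_groupE)
  have hG: "word_map M h \<in> G" unfolding G_def using word_map_permutes[OF hM] h(1) hid by simp
  obtain t where t: "h t \<noteq> t" using h(2) by (metis eq_id_iff)
  then obtain i where i: "h t i \<noteq> t i" by blast
  have iN: "i \<in> N" using i local_group_outside[OF N(2)] by metis
  let ?x = "restrict t M"
  obtain a where a: "a \<noteq> ?x j1" using ex_other_symbol[OF A] by blast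
  obtain b where b: "b \<noteq> ?x j2" using ex_other_symbol[OF A] by blast
  let ?y = "?x(j1 := a)" and ?z = "?x(j2 := b)"
  have W: "?x \<in> words M" "?y \<in> words M" "?z \<in> words M" using M by (auto simp: words_iff)
  have on_N: "s k = t k" if "s \<in> {?x, ?y, ?z}" "k \<in> N" for s k
    using that M j1 j2 by auto
  have hi: "h s i = h t i" if "s \<in> {?x, ?y, ?z}" for s
    using local_group_cong[OF N(2) on_N[OF that] iN] .
  \<comment> \<open>All three copies agree with \<open>t\<close> on \<open>N\<close>, so every image
    under \<open>h\<close> has the letter \<open>h t i\<close> at \<open>i\<close>, while every copy
    has \<open>t i\<close>.\<close>
  have cross: "s \<noteq> h s'" if "s \<in> {?x, ?y, ?z}" "s' \<in> {?x, ?y, ?z}" for s s'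
    using hi[OF that(2)] on_N[OF that(1) iN] i by metis
  have "?y j1 \<noteq> ?x j1" "?z j2 \<noteq> ?x j2" "?y j1 \<noteq> ?z j1" using a b j2 by auto
  then have xyz: "?x \<noteq> ?y" "?x \<noteq> ?z" "?y \<noteq> ?z" by metis+
  then have hxyz: "h ?x \<noteq> h ?y" "h ?x \<noteq> h ?z" "h ?y \<noteq> h ?z"
    using bij_local_group[OF N(2)] by (simp_all add: bij_is_inj inj_eq)
  have "distinct [?x, ?y, ?z, h ?x, h ?y, h ?z]"
    using xyz hxyz cross[of ?x ?x] cross[of ?x ?y] cross[of ?x ?z] cross[of ?y ?x] cross[of ?y ?y]
      cross[of ?y ?z] cross[of ?z ?x] cross[of ?z ?y] cross[of ?z ?z]
    by (simp del: fun_upd_apply)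
  then have "distinct [?x, ?y, ?z, word_map M h ?x, word_map M h ?y, word_map M h ?z]"
    using W by (simp only: word_map_def if_True)
  then obtain p q r where pqr: "p \<in> words M" "q \<in> words M" "r \<in> words M" "distinct [p, q, r]" "cyc3 p q r \<in> G"
    using ex_cyc3[OF hG W] by blast
  have "card (words M :: 'a config set) \<ge> 5" using c by simp
  then have "word_map M f \<in> G"
    using even_mem[OF _ pqr word_map_permutes[OF fM(1)]] fM(2) by (simp add: even_on_def)
  then show "f \<in> K" using fM(1) unfolding G_def by (metis (mono_tags, lifting) local_groupE mem_Collect_eq)
qed

section \<open>The action on finite points\<close>

lemma finite_points_outside:
  assumes "\<And>i. i \<notin> N \<Longrightarrow> y i = x i" "finite N" "x \<in> finite_points"
  shows "y \<in> finite_points"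
proof -
  have "{i. y i \<noteq> 0} \<subseteq> N \<union> {i. x i \<noteq> 0}" using assms(1) by force
  then show ?thesis using assms(2,3) unfolding finite_points_def by (simp add: finite_subset)
qed

lemma local_maps_finite_points:
  assumes "f \<in> local_maps"
  shows "f ` finite_points = finite_points"
proof -
  have sub: "g x \<in> finite_points" if "g \<in> local_maps" "x \<in> finite_points" for g and x :: "'a config"
    using that finite_points_outside[of _ "g x" x] local_group_outside unfolding local_maps_def by blast
  moreover have "f (inv_fun f x) = x" for x
    using bij_local_maps[OF assms] by (simp add: bij_is_surj surj_f_inv_f)
  ultimately show ?thesis using assms local_maps_inv[OF assms] by (metis image_subsetI imageI subsetI subset_antisym)
qed

text \<open>All the given points vanish outside one window, so the task becomes a partial injection
  of words, which \<open>ex_even_permutes\<close> extends.\<close>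

lemma even_maps_transitive:
  fixes x y :: "nat \<Rightarrow> 'a::{finite,zero} config"
  assumes A: "CARD('a) \<ge> 2"
    and x: "x ` {..<k} \<subseteq> finite_points" "inj_on x {..<k}"
    and y: "y ` {..<k} \<subseteq> finite_points" "inj_on y {..<k}"
  shows "\<exists>g\<in>even_maps. \<forall>i<k. g (x i) = y i"
proof -
  \<comment> \<open>The interval provides at least \<open>2 ^ (k + 2)\<close> words, hence two words
    besides the \<open>k\<close> prescribed ones.\<close>
  define M where "M = (\<Union>i<k. {j. x i j \<noteq> 0} \<union> {j. y i j \<noteq> 0}) \<union> {0..<int k + 2}"
  have M: "finite M" using x(1) y(1) by (auto simp: M_def finite_points_def)
  have out: "x i j = 0" "y i j = 0" if "i < k" "j \<notin> M" for i j
    using that by (auto simp: M_def)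
  let ?x = "\<lambda>i. restrict (x i) M" and ?y = "\<lambda>i. restrict (y i) M"
  have inj: "inj_on ?x {..<k}" "inj_on ?y {..<k}"
  proof -
    have "x i = x j" if "i < k" "j < k" "?x i = ?x j" for i j
      using that out unfolding restrict_eq_iff by (metis ext)
    then show "inj_on ?x {..<k}" using x(2) by (simp add: inj_on_def)
    have "y i = y j" if "i < k" "j < k" "?y i = ?y j" for i j
      using that out unfolding restrict_eq_iff by (metis ext)
    then show "inj_on ?y {..<k}" using y(2) by (simp add: inj_on_def)
  qed
  define T where "T = ?x ` {..<k}"
  define f where "f = ?y \<circ> inv_into {..<k} ?x"
  have f: "f (?x i) = ?y i" if "i < k" for i
    using inv_into_f_f[OF inj(1), of i] that by (simp add: f_def)
  have "card {0..<int k + 2} \<le> card M" using M by (intro card_mono) (auto simp: M_def)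
  then have "2 ^ (k + 2) \<le> card (words M :: 'a config set)" by (intro card_words_ge[OF A M]) simp
  moreover have "k + 2 \<le> 2 ^ (k + 2)" by (rule less_imp_le[OF less_exp])
  moreover have "card T = k" using card_image[OF inj(1)] by (simp add: T_def)
  ultimately have card: "card T + 2 \<le> card (words M :: 'a config set)" by simp
  have injf: "inj_on f T"
    unfolding T_def using f inj(2) by (auto simp: inj_on_def)
  have "T \<subseteq> words M" "f ` T \<subseteq> words M" unfolding T_def using f by auto
  then obtain p where p: "p permutes words M" "evenperm p" "\<And>t. t \<in> T \<Longrightarrow> p t = f t"
    using ex_even_permutes[OF finite_words[OF M] _ card injf] by metis
  have "local_perm M p (x i) = y i" if "i < k" for i
  proof
    fix j
    show "local_perm M p (x i) j = y i j"
      using that p(3)[of "?x i"] f[OF that] out[OF that] by (simp add: local_perm_def T_def)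
  qed
  then show ?thesis using even_mapsI[OF M p(1,2)] by blast
qed

section \<open>The groups\<close>

abbreviation homeos :: "('a config \<Rightarrow> 'a config) monoid" where
  "homeos \<equiv> homeo_group full_shift"

interpretation homeos: group "homeos :: ('a config \<Rightarrow> 'a config) monoid"
  by (rule group_homeo_group)

lemma one_homeos: "\<one>\<^bsub>homeos\<^esub> = id"
  by (simp add: homeo_group_def BijGroup_def fun_eq_iff)

lemma inv_homeos:
  assumes "f \<in> carrier homeos"
  shows "inv\<^bsub>homeos\<^esub> f = inv_fun f"
proof -
  have "f \<circ> inv\<^bsub>homeos\<^esub> f = id" "inv\<^bsub>homeos\<^esub> f \<circ> f = id"
    using homeos.r_inv[OF assms] homeos.l_inv[OF assms]
      mult_homeo_group_full_shift[OF assms homeos.inv_closed[OF assms]]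
      mult_homeo_group_full_shift[OF homeos.inv_closed[OF assms] assms]
    unfolding one_homeos by metis+
  then show ?thesis by (metis inv_unique_comp)
qed

lemma subgroup_homeos_iff: "subgroup H homeos \<longleftrightarrow> map_group H \<and> H \<subseteq> carrier homeos"
proof
  assume H: "subgroup H homeos"
  then have sub: "H \<subseteq> carrier homeos" by (rule subgroup.subset)
  have "f \<circ> g \<in> H" if "f \<in> H" "g \<in> H" for f g
    using subgroup.m_closed[OF H that]
    unfolding mult_homeo_group_full_shift[OF subsetD[OF sub that(1)] subsetD[OF sub that(2)]] .
  moreover have "inv_fun f \<in> H" if "f \<in> H" for f
    using subgroup.m_inv_closed[OF H that] unfolding inv_homeos[OF subsetD[OF sub that]] .
  moreover have "id \<in> H" using subgroup.one_closed[OF H] unfolding one_homeos .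
  ultimately show "map_group H \<and> H \<subseteq> carrier homeos" using sub by (simp add: map_group_def)
next
  assume "map_group H \<and> H \<subseteq> carrier homeos"
  then have H: "map_group H" and sub: "H \<subseteq> carrier homeos" by blast+
  show "subgroup H homeos"
  proof (rule homeos.subgroupI)
    show "H \<subseteq> carrier homeos" "H \<noteq> {}" using sub map_groupD(1)[OF H] by blast+
    show "inv\<^bsub>homeos\<^esub> f \<in> H" if "f \<in> H" for f
      unfolding inv_homeos[OF subsetD[OF sub that]] using map_groupD(3)[OF H that] .
    show "f \<otimes>\<^bsub>homeos\<^esub> g \<in> H" if "f \<in> H" "g \<in> H" for f g
      unfolding mult_homeo_group_full_shift[OF subsetD[OF sub that(1)] subsetD[OF sub that(2)]]
      using map_groupD(2)[OF H that] .
  qed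
qed

lemma map_group_carrier_homeos: "map_group (carrier homeos)"
  using subgroup_homeos_iff homeos.subgroup_self by blast

text \<open>\<open>G0\<close>, \<open>G0'\<close> and \<open>G0''\<close> are all generated
  subgroups of the homeomorphism group, so their structure is translated to functions once for all
  three.\<close>

lemma
  assumes "\<Gamma> = subgroup_generated homeos S"
  shows group_generated_maps: "group \<Gamma>"
    and carrier_generated_maps: "map_group (carrier \<Gamma>)" "carrier \<Gamma> \<subseteq> carrier homeos"
    and mult_generated_maps: "f \<in> carrier \<Gamma> \<Longrightarrow> g \<in> carrier \<Gamma> \<Longrightarrow> f \<otimes>\<^bsub>\<Gamma>\<^esub> g = f \<circ> g"
    and one_generated_maps: "\<one>\<^bsub>\<Gamma>\<^esub> = id"
    and inv_generated_maps: "f \<in> carrier \<Gamma> \<Longrightarrow> inv\<^bsub>\<Gamma>\<^esub> f = inv_fun f"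
    and subgroup_generated_maps_iff: "subgroup H \<Gamma> \<longleftrightarrow> map_group H \<and> H \<subseteq> carrier \<Gamma>"
proof -
  show sub: "carrier \<Gamma> \<subseteq> carrier homeos"
    unfolding assms by (rule homeos.carrier_subgroup_generated_subset)
  show "group \<Gamma>" unfolding assms by (rule homeos.group_subgroup_generated)
  have "subgroup (carrier \<Gamma>) homeos"
    unfolding assms by (rule homeos.subgroup_subgroup_generated)
  then show "map_group (carrier \<Gamma>)" using subgroup_homeos_iff by blast
  show "f \<otimes>\<^bsub>\<Gamma>\<^esub> g = f \<circ> g" if "f \<in> carrier \<Gamma>" "g \<in> carrier \<Gamma>"
    using mult_homeo_group_full_shift sub that unfolding assms mult_subgroup_generated by blast
  show "\<one>\<^bsub>\<Gamma>\<^esub> = id" unfolding assms by (simp add: one_homeos)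
  show "inv\<^bsub>\<Gamma>\<^esub> f = inv_fun f" if "f \<in> carrier \<Gamma>"
    using homeos.inv_subgroup_generated[OF that[unfolded assms]] inv_homeos[OF subsetD[OF sub that]]
    unfolding assms by simp
  show "subgroup H \<Gamma> \<longleftrightarrow> map_group H \<and> H \<subseteq> carrier \<Gamma>"
    using homeos.subgroup_subgroup_generated_iff[of H S] subgroup_homeos_iff[of H] sub
    unfolding assms by blast
qed

section \<open>Carriers and normal forms\<close>

lemma local_maps_homeos: "local_maps \<subseteq> carrier homeos"
  using local_perm_in_homeo_group by (auto simp: local_maps_def local_group_def words_def)

lemma map_group_local_maps: "map_group local_maps"
  using local_maps_id local_maps_comp local_maps_inv unfolding map_group_def by blast

lemma map_group_even_maps: "map_group (even_maps :: ('a::finite config \<Rightarrow> 'a config) set)"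
  using even_maps_id even_maps_comp even_maps_inv_iff even_maps_subset unfolding map_group_def by blast

text \<open>The generators already form a group, because any two local maps share a window.\<close>

lemma carrier_G0': "carrier G0' = (local_maps :: ('a config \<Rightarrow> 'a config) set)"
proof -
  have gens: "{local_perm N p | N p. finite N \<and> p permutes (N \<rightarrow>\<^sub>E UNIV)}
      = (local_maps :: ('a config \<Rightarrow> 'a config) set)"
    by (auto simp: local_maps_def local_group_def words_def)
  have "subgroup (local_maps :: ('a config \<Rightarrow> 'a config) set) homeos"
    using subgroup_homeos_iff map_group_local_maps local_maps_homeos by blast
  then show ?thesis
    unfolding G0'_def gens by (rule subgroup.carrier_subgroup_generated_subgroup)
qed

lemma carrier_G0'': "carrier G0'' = (even_maps :: ('a::finite config \<Rightarrow> 'a config) set)"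
proof -
  have gens: "{local_perm N p | N p. finite N \<and> p permutes (N \<rightarrow>\<^sub>E UNIV) \<and> evenperm p}
      = (even_maps :: ('a config \<Rightarrow> 'a config) set)"
    unfolding words_def[symmetric]
  proof (intro equalityI subsetI)
    fix f :: "'a config \<Rightarrow> 'a config"
    assume "f \<in> {local_perm N p | N p. finite N \<and> p permutes words N \<and> evenperm p}"
    then show "f \<in> even_maps" using even_mapsI by blast
  next
    fix f :: "'a config \<Rightarrow> 'a config"
    assume "f \<in> even_maps"
    then obtain N where "finite N" "f \<in> local_group N" "even_on N f" by (auto simp: even_maps_def)
    then have "f = local_perm N (word_map N f)" "finite N" "word_map N f permutes words N"
      "evenperm (word_map N f)"
      by (auto simp: even_on_def elim: local_groupE)
    then show "f \<in> {local_perm N p | N p. finite N \<and> p permutes words N \<and> evenperm p}" by blast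
  qed
  have "subgroup (even_maps :: ('a config \<Rightarrow> 'a config) set) homeos"
    using subgroup_homeos_iff map_group_even_maps local_maps_homeos even_maps_subset by blast
  then show ?thesis
    unfolding G0''_def gens by (rule subgroup.carrier_subgroup_generated_subgroup)
qed

text \<open>Normal form of the elements of \<open>G0\<close>: the shift normalises
  \<open>local_maps\<close>, so its powers can be collected on the left.\<close>

definition shifted_maps :: "('a config \<Rightarrow> 'a config) set" where
  "shifted_maps = {sh n \<circ> f | n f. f \<in> local_maps}"

lemma shifted_mapsI: "f \<in> local_maps \<Longrightarrow> sh n \<circ> f \<in> shifted_maps"
  unfolding shifted_maps_def by blast

lemma shifted_mapsE:
  assumes "g \<in> shifted_maps"
  obtains n f where "g = sh n \<circ> f" "f \<in> local_maps"
  using assms unfolding shifted_maps_def by blast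

lemma shifted_mult: "(sh m \<circ> f) \<circ> (sh n \<circ> g) = sh (m + n) \<circ> (translate (- n) f \<circ> g)"
  by (simp add: translate_def fun_eq_iff)

lemma shifted_inv:
  assumes "f \<in> local_maps"
  shows "inv_fun (sh m \<circ> f) = sh (- m) \<circ> translate m (inv_fun f)"
  using bij_local_maps[OF assms]
  by (simp add: o_inv_distrib bij_sh inv_sh) (simp add: translate_def fun_eq_iff)

lemma map_group_shifted_maps: "map_group (shifted_maps :: ('a config \<Rightarrow> 'a config) set)"
  unfolding map_group_def
proof (intro conjI ballI)
  have "id = sh 0 \<circ> id" by (simp only: sh_0 comp_id)
  then show "id \<in> shifted_maps" using local_maps_id unfolding shifted_maps_def by blast
  show "f \<circ> g \<in> shifted_maps" if fS: "f \<in> shifted_maps" and gS: "g \<in> shifted_maps" for f g :: "'a config \<Rightarrow> 'a config"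
  proof -
    obtain m f' where f: "f = sh m \<circ> f'" "f' \<in> local_maps" using fS by (rule shifted_mapsE)
    obtain n g' where g: "g = sh n \<circ> g'" "g' \<in> local_maps" using gS by (rule shifted_mapsE)
    show ?thesis
      unfolding f(1) g(1) shifted_mult
      by (intro shifted_mapsI local_maps_comp local_maps_translate f(2) g(2))
  qed
  show "inv_fun f \<in> shifted_maps" if fS: "f \<in> shifted_maps" for f :: "'a config \<Rightarrow> 'a config"
  proof -
    obtain m f' where f: "f = sh m \<circ> f'" "f' \<in> local_maps" using fS by (rule shifted_mapsE)
    show ?thesis
      unfolding f(1) shifted_inv[OF f(2)]
      by (intro shifted_mapsI local_maps_translate local_maps_inv f(2))
  qed
qed

lemma local_maps_shifted: "local_maps \<subseteq> shifted_maps"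
proof
  fix f :: "'a config \<Rightarrow> 'a config" assume "f \<in> local_maps"
  moreover have "f = sh 0 \<circ> f" by (simp add: sh_0)
  ultimately show "f \<in> shifted_maps" unfolding shifted_maps_def by blast
qed

lemma sh_shifted: "sh n \<in> shifted_maps"
proof -
  have "sh n = sh n \<circ> id" by simp
  then show ?thesis using local_maps_id unfolding shifted_maps_def by blast
qed

lemma shifted_maps_subset:
  assumes "map_group H" "shift \<in> H" "local_maps \<subseteq> H"
  shows "shifted_maps \<subseteq> H"
  using sh_mem[OF assms(1,2)] assms(3) map_groupD(2)[OF assms(1)] unfolding shifted_maps_def by blast

lemma carrier_G0: "carrier G0 = shifted_maps"
proof
  have "shifted_maps \<subseteq> carrier homeos"
    using shifted_maps_subset map_group_carrier_homeos shift_in_homeo_group local_maps_homeos by blast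
  then have "subgroup shifted_maps homeos" using subgroup_homeos_iff map_group_shifted_maps by blast
  moreover have "insert shift (carrier G0') \<subseteq> shifted_maps"
    unfolding carrier_G0' shift_eq_sh using local_maps_shifted sh_shifted by blast
  ultimately show "carrier G0 \<subseteq> shifted_maps"
    unfolding G0_def by (rule homeos.subgroup_generated_minimal)
next
  have "insert shift (carrier G0') \<subseteq> carrier G0"
    unfolding G0_def carrier_G0' using shift_in_homeo_group local_maps_homeos
    by (intro homeos.subgroup_generated_subset_carrier_subset) auto
  then show "shifted_maps \<subseteq> carrier G0"
    using shifted_maps_subset[OF carrier_generated_maps(1)[OF G0_def]] unfolding carrier_G0' by blast
qed

lemma finitely_generated_G0:
  assumes A: "CARD('a::finite) \<ge> 2"
  shows "finitely_generated_group (G0 :: ('a config \<Rightarrow> 'a config) monoid)"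
proof -
  let ?G = "G0 :: ('a config \<Rightarrow> 'a config) monoid"
  let ?S = "insert shift (local_group {0..<3}) :: ('a config \<Rightarrow> 'a config) set"
  interpret group ?G by (rule group_generated_maps[OF G0_def])
  have "local_group {0..<3} \<subseteq> (local_maps :: ('a config \<Rightarrow> 'a config) set)"
    unfolding local_maps_def by blast
  then have S: "?S \<subseteq> carrier ?G"
    unfolding carrier_G0 shift_eq_sh using local_maps_shifted sh_shifted by blast
  have H: "map_group (generate ?G ?S)"
    using generate_is_subgroup[OF S] subgroup_generated_maps_iff[OF G0_def] by blast
  have m: "shift \<in> generate ?G ?S" "local_group {0..<3} \<subseteq> generate ?G ?S"
    by (auto intro: generate.incl)
  have "carrier ?G \<subseteq> generate ?G ?S"
    unfolding carrier_G0 using shifted_maps_subset[OF H m(1) local_maps_generated[OF A H m]] .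
  then have "generate ?G ?S = carrier ?G" using generate_incl[OF S] by blast
  moreover have "finite ?S" by (simp add: finite_local_group)
  ultimately show ?thesis unfolding finitely_generated_group_def using S is_group by blast
qed

text \<open>The powers of the shift cancel, leaving translates of \<open>f\<close>, \<open>g\<close>
  and their inverses; each sign occurs twice.\<close>

lemma commutator_shifted:
  fixes f g :: "'a::finite config \<Rightarrow> 'a config"
  assumes "f \<in> local_maps" "g \<in> local_maps"
  shows "(sh a \<circ> f) \<circ> (sh b \<circ> g) \<circ> inv_fun (sh a \<circ> f) \<circ> inv_fun (sh b \<circ> g) \<in> even_maps"
proof -
  note l = assms local_maps_inv[OF assms(1)] local_maps_inv[OF assms(2)]
  have "(sh a \<circ> f) \<circ> (sh b \<circ> g) \<circ> inv_fun (sh a \<circ> f) \<circ> inv_fun (sh b \<circ> g)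
     = translate a f \<circ> translate (a + b) g \<circ> translate (a + b) (inv_fun f) \<circ> translate b (inv_fun g)"
    unfolding shifted_inv[OF assms(1)] shifted_inv[OF assms(2)]
    by (simp add: translate_def fun_eq_iff)
  also have "\<dots> \<in> even_maps"
    using assms l by (simp add: even_maps_comp_iff local_maps_comp local_maps_translate
        even_maps_translate_iff even_maps_inv_iff) blast
  finally show ?thesis .
qed

text \<open>Commutators have trivial sign, which bounds the derived subgroup from above; perfectness
  of \<open>even_maps\<close> bounds it from below.\<close>

lemma derived_G0:
  assumes A: "CARD('a::finite) \<ge> 2"
  shows "derived G0 (carrier G0) = (even_maps :: ('a config \<Rightarrow> 'a config) set)"
proof
  let ?G = "G0 :: ('a config \<Rightarrow> 'a config) monoid"
  interpret group ?G by (rule group_generated_maps[OF G0_def])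
  have comm: "f \<otimes>\<^bsub>?G\<^esub> g \<otimes>\<^bsub>?G\<^esub> inv\<^bsub>?G\<^esub> f \<otimes>\<^bsub>?G\<^esub> inv\<^bsub>?G\<^esub> g = f \<circ> g \<circ> inv_fun f \<circ> inv_fun g"
    if "f \<in> carrier ?G" "g \<in> carrier ?G" for f g
    using that map_groupD[OF carrier_generated_maps(1)[OF G0_def[where 'a = 'a]]]
    by (simp add: mult_generated_maps[OF G0_def] inv_generated_maps[OF G0_def])
  have sub: "even_maps \<subseteq> carrier ?G"
    unfolding carrier_G0 using even_maps_subset local_maps_shifted by blast
  have "derived_set ?G (carrier ?G) \<subseteq> even_maps"
  proof
    fix k assume "k \<in> derived_set ?G (carrier ?G)"
    then obtain f g where fg: "f \<in> carrier ?G" "g \<in> carrier ?G"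
      "k = f \<otimes>\<^bsub>?G\<^esub> g \<otimes>\<^bsub>?G\<^esub> inv\<^bsub>?G\<^esub> f \<otimes>\<^bsub>?G\<^esub> inv\<^bsub>?G\<^esub> g" by blast
    then have "k = f \<circ> g \<circ> inv_fun f \<circ> inv_fun g" using comm by simp
    moreover obtain a f' where f: "f = sh a \<circ> f'" "f' \<in> local_maps"
      using fg(1) unfolding carrier_G0 by (rule shifted_mapsE)
    moreover obtain b g' where g: "g = sh b \<circ> g'" "g' \<in> local_maps"
      using fg(2) unfolding carrier_G0 by (rule shifted_mapsE)
    ultimately show "k \<in> even_maps" using commutator_shifted[OF f(2) g(2)] by simp
  qed
  moreover have "subgroup even_maps ?G"
    using subgroup_generated_maps_iff[OF G0_def] map_group_even_maps sub by blast
  ultimately show "derived ?G (carrier ?G) \<subseteq> even_maps"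
    unfolding derived_def by (rule generate_subgroup_incl)
  have D: "map_group (derived ?G (carrier ?G))"
    using derived_is_subgroup[OF subset_refl] subgroup_generated_maps_iff[OF G0_def] by blast
  show "even_maps \<subseteq> derived ?G (carrier ?G)"
  proof (rule even_maps_subset_commutators[OF A D])
    fix f g :: "'a config \<Rightarrow> 'a config" assume "f \<in> even_maps" "g \<in> even_maps"
    then have fg: "f \<in> carrier ?G" "g \<in> carrier ?G" using sub by blast+
    then have "f \<otimes>\<^bsub>?G\<^esub> g \<otimes>\<^bsub>?G\<^esub> inv\<^bsub>?G\<^esub> f \<otimes>\<^bsub>?G\<^esub> inv\<^bsub>?G\<^esub> g \<in> derived ?G (carrier ?G)"
      unfolding derived_def by (intro generate.incl) blast
    then show "f \<circ> g \<circ> inv_fun f \<circ> inv_fun g \<in> derived ?G (carrier ?G)" using comm[OF fg] by simp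
  qed
qed

lemma finite_common_window:
  assumes "finite S" "S \<subseteq> local_maps"
  obtains M where "finite M" "S \<subseteq> local_group M"
proof -
  have "\<forall>f\<in>S. \<exists>N. finite N \<and> f \<in> local_group N" using assms(2) by (auto simp: local_maps_def)
  then obtain W where W: "\<forall>f\<in>S. finite (W f) \<and> f \<in> local_group (W f)" by metis
  show thesis
  proof
    show "finite (\<Union>f\<in>S. W f)" using W assms(1) by blast
    show "S \<subseteq> local_group (\<Union>f\<in>S. W f)"
    proof
      fix f assume f: "f \<in> S"
      then have "W f \<subseteq> (\<Union>f\<in>S. W f)" by blast
      then show "f \<in> local_group (\<Union>f\<in>S. W f)" using local_group_mono W f by blast
    qed
  qed
qed

text \<open>Finitely many even maps share one window \<open>M\<close>, so they generate a subgroup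
  of the finite group \<open>local_group M\<close>.\<close>

lemma locally_finite_G0'':
  "locally_finite_group (G0'' :: ('a::finite config \<Rightarrow> 'a config) monoid)"
  unfolding locally_finite_group_def
proof (intro conjI allI impI)
  let ?G = "G0'' :: ('a config \<Rightarrow> 'a config) monoid"
  show "group ?G" by (rule group_generated_maps[OF G0''_def])
  then interpret group ?G .
  fix H assume H: "subgroup H ?G" and "finitely_generated_group (?G\<lparr>carrier := H\<rparr>)"
  then obtain S where S: "finite S" "S \<subseteq> H" "generate (?G\<lparr>carrier := H\<rparr>) S = H"
    by (auto simp: finitely_generated_group_def)
  have "S \<subseteq> even_maps" using S(2) subgroup.subset[OF H] unfolding carrier_G0'' by blast
  then obtain M where M: "finite M" "S \<subseteq> local_group M"
    using finite_common_window[OF S(1)] even_maps_subset by blast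
  have "map_group (even_maps \<inter> local_group M :: ('a config \<Rightarrow> 'a config) set)"
    unfolding map_group_def Int_iff
    by (intro conjI ballI map_groupD[OF map_group_even_maps] local_group_id local_group_comp
        local_group_inv) auto
  then have "subgroup (even_maps \<inter> local_group M) ?G"
    using subgroup_generated_maps_iff[OF G0''_def] carrier_G0'' by blast
  then have "generate ?G S \<subseteq> even_maps \<inter> local_group M"
    using M(2) \<open>S \<subseteq> even_maps\<close> by (intro generate_subgroup_incl) auto
  then have "H \<subseteq> local_group M" using S(3) generate_consistent[OF S(2) H] by blast
  then show "finite H" using finite_local_group[OF M(1)] finite_subset by blast
qed

lemma infinitely_transitive_G0'':
  assumes A: "CARD('a::{finite,zero}) \<ge> 2"
  shows "infinitely_transitive_on (carrier G0'') (finite_points :: 'a config set)"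
  unfolding infinitely_transitive_on_def carrier_G0''
  using even_maps_transitive[OF A] local_maps_finite_points even_maps_subset by blast

lemma ex_nontrivial_even_map:
  assumes A: "CARD('a::{finite,zero}) \<ge> 2"
  shows "\<exists>g\<in>even_maps. g \<noteq> (id :: 'a config \<Rightarrow> 'a config)"
proof -
  obtain b :: 'a where b: "b \<noteq> 0" using ex_other_symbol[OF A] by blast
  let ?x = "\<lambda>_::nat. (\<lambda>_. 0) :: 'a config" and ?y = "\<lambda>_::nat. (\<lambda>_. 0)(0 := b) :: 'a config"
  have "(?x 0) \<in> finite_points" "(?y 0) \<in> finite_points" by (auto simp: finite_points_def)
  then have "\<exists>g\<in>even_maps. \<forall>i<1. g (?x i) = ?y i"
    by (intro even_maps_transitive[OF A]) (auto simp: inj_on_def)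
  then obtain g where g: "g \<in> even_maps" "g (\<lambda>_. 0 :: 'a) = (\<lambda>_. 0)(0 := b)" by blast
  have "(g (\<lambda>_. 0 :: 'a)) 0 \<noteq> 0" using g(2) b by simp
  then show ?thesis using g(1) by (metis id_apply)
qed

lemma simple_G0'':
  assumes A: "CARD('a::{finite,zero}) \<ge> 2"
  shows "is_simple_group (G0'' :: ('a config \<Rightarrow> 'a config) monoid)"
  unfolding is_simple_group_def
proof (intro conjI allI impI)
  let ?G = "G0'' :: ('a config \<Rightarrow> 'a config) monoid"
  show "group ?G" by (rule group_generated_maps[OF G0''_def])
  then interpret group ?G .
  show "carrier ?G \<noteq> {\<one>\<^bsub>?G\<^esub>}"
    using ex_nontrivial_even_map[OF A] unfolding carrier_G0'' one_generated_maps[OF G0''_def] by blast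
  fix K assume K: "K \<lhd> ?G"
  have sK: "subgroup K ?G" using K by (rule normal_imp_subgroup)
  then have Km: "map_group K" "K \<subseteq> even_maps"
    using subgroup_generated_maps_iff[OF G0''_def] carrier_G0'' by blast+
  have conj: "c \<circ> k \<circ> inv_fun c \<in> K" if k: "k \<in> K" and c: "c \<in> even_maps" for k c
  proof -
    have cG: "c \<in> carrier ?G" "k \<in> carrier ?G" "inv_fun c \<in> carrier ?G" "c \<circ> k \<in> carrier ?G"
      using c k Km map_groupD[OF map_group_even_maps[where 'a = 'a]] unfolding carrier_G0'' by blast+
    have "c \<otimes>\<^bsub>?G\<^esub> k \<otimes>\<^bsub>?G\<^esub> inv\<^bsub>?G\<^esub> c \<in> K" using normal.inv_op_closed2[OF K cG(1) k] .
    then show ?thesis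
      using cG by (simp add: mult_generated_maps[OF G0''_def] inv_generated_maps[OF G0''_def])
  qed
  show "K = {\<one>\<^bsub>?G\<^esub>} \<or> K = carrier ?G"
  proof (cases "\<exists>h\<in>K. h \<noteq> id")
    case True
    then show ?thesis using even_maps_minimal[OF A Km conj] Km(2) unfolding carrier_G0'' by blast
  next
    case False
    then show ?thesis using map_groupD(1)[OF Km(1)] unfolding one_generated_maps[OF G0''_def] by blast
  qed
qed

section \<open>The shift degree\<close>

text \<open>Far from a common window of \<open>f\<close> and \<open>g\<close> both sides are pure
  shifts, and the sites they read tell the exponents apart.\<close>

lemma shifted_degree_unique:
  fixes f g :: "'a::finite config \<Rightarrow> 'a config"
  assumes A: "CARD('a) \<ge> 2" and f: "f \<in> local_maps" and g: "g \<in> local_maps"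
    and eq: "sh m \<circ> f = sh n \<circ> g"
  shows "m = n"
proof (rule ccontr)
  assume "m \<noteq> n"
  obtain N where N: "finite N" "f \<in> local_group N" "g \<in> local_group N" using common_window[OF f g] .
  have "finite ((\<lambda>i. i - m) ` N \<union> (\<lambda>i. i - n) ` N)" using N(1) by simp
  then obtain i where "i \<notin> (\<lambda>i. i - m) ` N \<union> (\<lambda>i. i - n) ` N"
    using ex_new_if_finite[OF infinite_UNIV_int] by blast
  then have i: "i + m \<notin> N" "i + n \<notin> N" unfolding Un_iff in_translated_window by blast+
  obtain b :: 'a where b: "b \<noteq> undefined" using ex_other_symbol[OF A] by blast
  \<comment> \<open>A single letter differs from the background, at the site that
    \<open>sh m\<close> reads at \<open>i\<close>.\<close>
  let ?x = "(\<lambda>_. undefined)(i + m := b)"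
  have "?x (i + m) = f ?x (i + m)" using local_group_outside[OF N(2) i(1)] by metis
  also have "\<dots> = (sh m \<circ> f) ?x i" by (simp add: sh_def)
  also have "\<dots> = g ?x (i + n)" unfolding eq by (simp add: sh_def)
  also have "\<dots> = ?x (i + n)" using local_group_outside[OF N(3) i(2)] .
  finally show False using b \<open>m \<noteq> n\<close> by simp
qed

definition shift_degree :: "('a config \<Rightarrow> 'a config) \<Rightarrow> int" where
  "shift_degree g = (THE n. \<exists>f\<in>local_maps. g = sh n \<circ> f)"

lemma shift_degree:
  fixes f :: "'a::finite config \<Rightarrow> 'a config"
  assumes A: "CARD('a) \<ge> 2" and f: "f \<in> local_maps"
  shows "shift_degree (sh n \<circ> f) = n"
  unfolding shift_degree_def
proof (rule the_equality)
  show "\<exists>g\<in>local_maps. sh n \<circ> f = sh n \<circ> g" using f by blast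
  show "m = n" if "\<exists>g\<in>local_maps. sh n \<circ> f = sh m \<circ> g" for m
    using shifted_degree_unique[OF A f] that by metis
qed

text \<open>Restricted to the carrier because a homomorphism, as a total function, can only be
  unique once its values elsewhere are fixed.\<close>

definition degree_hom :: "('a config \<Rightarrow> 'a config) \<Rightarrow> int" where
  "degree_hom = restrict shift_degree (carrier G0)"

lemma degree_hom:
  assumes A: "CARD('a::finite) \<ge> 2"
  shows "degree_hom \<in> hom (G0 :: ('a config \<Rightarrow> 'a config) monoid) integer_group"
    and "degree_hom (shift :: 'a config \<Rightarrow> 'a config) = 1"
    and "degree_hom ` carrier (G0' :: ('a config \<Rightarrow> 'a config) monoid) = {0}"
    and "kernel (G0 :: ('a config \<Rightarrow> 'a config) monoid) integer_group degree_hom = carrier G0'"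
proof -
  let ?G = "G0 :: ('a config \<Rightarrow> 'a config) monoid"
  have deg: "degree_hom (sh n \<circ> f) = n" if "f \<in> local_maps" for n and f :: "'a config \<Rightarrow> 'a config"
    unfolding degree_hom_def carrier_G0 using shift_degree[OF A that] that
    by (auto simp: shifted_maps_def)
  show "degree_hom \<in> hom ?G integer_group"
  proof (rule homI)
    fix f g assume fg: "f \<in> carrier ?G" "g \<in> carrier ?G"
    obtain m f' where f: "f = sh m \<circ> f'" "f' \<in> local_maps"
      using fg(1) unfolding carrier_G0 by (rule shifted_mapsE)
    obtain n g' where g: "g = sh n \<circ> g'" "g' \<in> local_maps"
      using fg(2) unfolding carrier_G0 by (rule shifted_mapsE)
    have "degree_hom (f \<circ> g) = m + n"
      unfolding f(1) g(1) shifted_mult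
      by (intro deg local_maps_comp local_maps_translate f(2) g(2))
    then show "degree_hom (f \<otimes>\<^bsub>?G\<^esub> g) = degree_hom f \<otimes>\<^bsub>integer_group\<^esub> degree_hom g"
      using deg[OF f(2), of m] deg[OF g(2), of n] mult_generated_maps[OF G0_def fg] f(1) g(1) by simp
  qed simp
  have "shift = sh 1 \<circ> (id :: 'a config \<Rightarrow> 'a config)" by (simp add: shift_eq_sh)
  then show "degree_hom (shift :: 'a config \<Rightarrow> 'a config) = 1" using deg[OF local_maps_id] by metis
  have zero: "degree_hom f = 0" if "f \<in> local_maps" for f :: "'a config \<Rightarrow> 'a config"
    using deg[OF that, of 0] by (simp add: sh_0)
  have "degree_hom ` (local_maps :: ('a config \<Rightarrow> 'a config) set)
      = (\<lambda>_. 0) ` (local_maps :: ('a config \<Rightarrow> 'a config) set)"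
    by (rule image_cong) (simp_all add: zero)
  then show "degree_hom ` carrier (G0' :: ('a config \<Rightarrow> 'a config) monoid) = {0}"
    unfolding carrier_G0' image_constant[OF local_maps_id] .
  show "kernel ?G integer_group degree_hom = carrier G0'"
  proof (intro equalityI subsetI)
    fix g assume "g \<in> kernel ?G integer_group degree_hom"
    then have "g \<in> shifted_maps" "degree_hom g = 0" by (simp_all add: kernel_def carrier_G0)
    moreover then obtain n f where "g = sh n \<circ> f" "f \<in> local_maps" by (elim shifted_mapsE)
    ultimately show "g \<in> carrier G0'" using deg by (simp add: sh_0 carrier_G0')
  next
    fix g :: "'a config \<Rightarrow> 'a config" assume "g \<in> carrier G0'"
    then show "g \<in> kernel ?G integer_group degree_hom"
      using zero local_maps_shifted by (auto simp: kernel_def carrier_G0 carrier_G0')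
  qed
qed

text \<open>The value on \<open>shift\<close> settles all its powers, local maps go to 0, and the
  normal form does the rest; outside the carrier extensionality decides.\<close>

lemma degree_hom_unique:
  fixes \<psi> :: "('a::finite config \<Rightarrow> 'a config) \<Rightarrow> int"
  assumes A: "CARD('a) \<ge> 2" and \<psi>: "\<psi> \<in> hom G0 integer_group" "\<psi> \<in> extensional (carrier G0)"
    and gens: "\<psi> shift = 1" "\<psi> ` carrier G0' = {0}"
  shows "\<psi> = degree_hom"
proof
  fix g
  have comp: "\<psi> (f \<circ> h) = \<psi> f + \<psi> h" if "f \<in> carrier G0" "h \<in> carrier G0" for f h
    using hom_mult[OF \<psi>(1) that] mult_generated_maps[OF G0_def that] by simp
  have shG: "sh n \<in> carrier (G0 :: ('a config \<Rightarrow> 'a config) monoid)" for n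
    unfolding carrier_G0 by (rule sh_shifted)
  have add: "\<psi> (sh (m + n)) = \<psi> (sh m) + \<psi> (sh n)" for m n
    using comp[OF shG shG] by (simp add: sh_add)
  have zero: "\<psi> (sh 0) = 0" using add[of 0 0] unfolding add_0 by linarith
  have nat: "\<psi> (sh (int k)) = int k" for k
  proof (induction k)
    case 0
    show ?case using zero unfolding of_nat_0 .
  next
    case (Suc k)
    then show ?case using add[of 1 "int k"] gens(1) by (simp add: shift_eq_sh)
  qed
  have sh: "\<psi> (sh n) = n" for n
  proof (cases "n \<ge> 0")
    case True
    then show ?thesis using nat[of "nat n"] by simp
  next
    case False
    moreover have "0 = \<psi> (sh n) + \<psi> (sh (- n))" using add[of n "- n"] unfolding add.right_inverse zero .
    ultimately show ?thesis using nat[of "nat (- n)"] by simp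
  qed
  show "\<psi> g = degree_hom g"
  proof (cases "g \<in> carrier G0")
    case False
    then show ?thesis using \<psi>(2) by (simp add: degree_hom_def extensional_def)
  next
    case True
    obtain n f where g: "g = sh n \<circ> f" "f \<in> local_maps"
      using True unfolding carrier_G0 by (rule shifted_mapsE)
    have "f \<in> carrier G0" unfolding carrier_G0 using g(2) local_maps_shifted by blast
    then have "\<psi> g = \<psi> (sh n) + \<psi> f" unfolding g(1) by (rule comp[OF shG])
    moreover have "\<psi> f = 0" using gens(2) g(2) unfolding carrier_G0' by blast
    ultimately have "\<psi> g = n" using sh by simp
    moreover have "degree_hom g = n"
      using True shift_degree[OF A g(2)] unfolding degree_hom_def g(1) by simp
    ultimately show ?thesis by simp
  qed
qed

theorem lemma5p4:
  assumes "CARD('a::{finite,zero}) \<ge> 2"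
  shows "finitely_generated_group (G0 :: ('a config \<Rightarrow> 'a config) monoid)
    \<and> (carrier (G0'' :: ('a config \<Rightarrow> 'a config) monoid) = derived G0 (carrier G0)
        \<and> locally_finite_group (G0'' :: ('a config \<Rightarrow> 'a config) monoid)
        \<and> is_simple_group (G0'' :: ('a config \<Rightarrow> 'a config) monoid))
    \<and> infinitely_transitive_on (carrier G0'') (finite_points :: 'a config set)
    \<and> (\<exists>!\<psi>. \<psi> \<in> hom (G0 :: ('a config \<Rightarrow> 'a config) monoid) integer_group
              \<and> \<psi> \<in> extensional (carrier G0)
              \<and> \<psi> shift = 1 \<and> \<psi> ` carrier G0' = {0})
    \<and> (\<forall>\<psi>. \<psi> \<in> hom (G0 :: ('a config \<Rightarrow> 'a config) monoid) integer_group
              \<and> \<psi> \<in> extensional (carrier G0)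
              \<and> \<psi> shift = 1 \<and> \<psi> ` carrier G0' = {0}
            \<longrightarrow> carrier G0' = kernel G0 integer_group \<psi>)"
proof (intro conjI)
  let ?P = "\<lambda>\<psi>. \<psi> \<in> hom (G0 :: ('a config \<Rightarrow> 'a config) monoid) integer_group
              \<and> \<psi> \<in> extensional (carrier G0)
              \<and> \<psi> shift = 1 \<and> \<psi> ` carrier G0' = {0}"
  \<comment> \<open>Identifying every such homomorphism with \<open>degree_hom\<close> gives
    uniqueness and also transfers the computation of its kernel.\<close>
  have unique: "\<psi> = degree_hom" if "?P \<psi>" for \<psi>
    using degree_hom_unique[OF assms] that by blast
  have ext: "degree_hom \<in> extensional (carrier (G0 :: ('a config \<Rightarrow> 'a config) monoid))"
    unfolding degree_hom_def by simp
  show "\<exists>!\<psi>. ?P \<psi>"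
    using degree_hom(1-3)[OF assms] ext unique by (intro ex1I[of _ degree_hom]) blast+
  show "\<forall>\<psi>. ?P \<psi> \<longrightarrow> carrier G0' = kernel G0 integer_group \<psi>"
    using unique degree_hom(4)[OF assms] by blast
qed (use assms in \<open>simp_all add: finitely_generated_G0 derived_G0 carrier_G0'' locally_finite_G0''
    simple_G0'' infinitely_transitive_G0''[unfolded carrier_G0'']\<close>)

end
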